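(* For every $k\ge 3$, the Loomis-Whitney join $$LW_k = S_1(x_2,\dots,x_k), S_2(x_1,x_3,\dots,x_k),\dots,S_k(x_1,\dots,x_{k-1}),$$ on input in which all relations have the same size $M$ in bits, can be computed by an MPC algorithm with $p$ servers in 2 rounds with load $\tilde{O}\big(M/p^{1-1/k}\big)$.
   Context: The query asks for all tuples $(x_1,\dots,x_k)$ satisfying all the relations (natural join of $k$ distinct relations, $S_i$ containing all variables except $x_i$). All relations have $m$ tuples over a domain $[n]$ and size $M=(k-1)m\log n$ bits. MPC model. There are $p$ servers connected by a complete network of private channels. Computation proceeds in synchronous rounds, each consisting of a communication phase (servers exchange data) and a computation phase (unrestricted local computation). The input is initially partitioned evenly among the $p$ servers. At the end, the union of the outputs of the servers must be the full set of answers to the query. The load is the maximum number of bits received by any server during any round. Conventions. $k$ is fixed (constants may depend on it). $\tilde O$ hides factors polylogarithmic in $p$. Algorithms may use randomness (random hash functions), and the load bound holds with high probability (probability tending to $1$ as $p\to\infty$, uniformly over inputs). Data statistics, namely relation sizes and information about heavy hitters (values, or tuples of values, of high frequency in a relation, with their frequencies), are available to the servers. Relation sizes are large compared with $p$ ($m\ge p^{c}$ for a suitable constant $c$ depending only on the query). There is no other assumption on the data distribution. *)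

theory Defs
  imports "HOL-Probability.Probability"
begin

section \<open>Natural joins and the Loomis-Whitney query\<close>

text \<open>Variables are the naturals \<open>1, \<dots>, k\<close> (for \<open>x\<^sub>1, \<dots>, x\<^sub>k\<close>). A tuple is a finite map from
  variables to values, and a relation over a set \<open>V\<close> of variables consists of maps with domain
  exactly \<open>V\<close>. Thus restricting a tuple to a set of variables (projection) is \<open>t |` V\<close>.\<close>

type_synonym tuple = "nat \<rightharpoonup> nat"

definition is_relation :: "nat \<Rightarrow> nat set \<Rightarrow> tuple set \<Rightarrow> bool" where
  "is_relation n V R \<longleftrightarrow> (\<forall>t\<in>R. dom t = V \<and> ran t \<subseteq> {1..n})"

definition natural_join :: "nat set \<Rightarrow> (nat \<Rightarrow> nat set) \<Rightarrow> (nat \<Rightarrow> tuple set) \<Rightarrow> tuple set" where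
  "natural_join I V S = {x. dom x = (\<Union>i\<in>I. V i) \<and> (\<forall>i\<in>I. x |` V i \<in> S i)}"

definition lw_vars :: "nat \<Rightarrow> nat \<Rightarrow> nat set" where
  "lw_vars k i = {1..k} - {i}"

definition lw_instance :: "nat \<Rightarrow> nat \<Rightarrow> nat \<Rightarrow> (nat \<Rightarrow> tuple set) \<Rightarrow> bool" where
  "lw_instance k n m S \<longleftrightarrow> (\<forall>i\<in>{1..k}. is_relation n (lw_vars k i) (S i) \<and> card (S i) = m)"

definition lw_join :: "nat \<Rightarrow> (nat \<Rightarrow> tuple set) \<Rightarrow> tuple set" where
  "lw_join k S = natural_join {1..k} (lw_vars k) S"

text \<open>Size in bits of one relation: \<open>m\<close> tuples, each made of \<open>k - 1\<close> values of \<open>log n\<close> bits.\<close>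

definition lw_bits :: "nat \<Rightarrow> nat \<Rightarrow> nat \<Rightarrow> real" where
  "lw_bits k n m = (real k - 1) * real m * log 2 (real n)"

section \<open>Data statistics\<close>

text \<open>The frequency of a partial tuple \<open>h\<close> in a relation is the number of tuples that agree with
  \<open>h\<close> on \<open>dom h\<close>. A partial tuple is a heavy hitter of a relation with \<open>m > 0\<close> tuples if its frequency
  is at least \<open>m / p\<close>; hence there are only \<open>O(p)\<close> of them (the constant depending on the arity),
  and the statistics do not determine the data. The empty partial tuple is always a heavy hitter;
  its frequency is the size of the relation.\<close>

definition frequency :: "tuple set \<Rightarrow> tuple \<Rightarrow> nat" where
  "frequency R h = card {t \<in> R. h \<subseteq>\<^sub>m t}"

type_synonym statistics = "(nat \<times> tuple \<times> nat) set"

definition heavy_hitters :: "nat \<Rightarrow> nat \<Rightarrow> nat \<Rightarrow> (nat \<Rightarrow> tuple set) \<Rightarrow> statistics" where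
  "heavy_hitters k p m S =
     {(i, h, f). i \<in> {1..k} \<and> f = frequency (S i) h \<and> real f \<ge> real m / real p}"

section \<open>The MPC model\<close>

text \<open>A fact \<open>(i, t)\<close> says that \<open>t\<close> is a tuple of the \<open>i\<close>-th relation. Servers are \<open>0, \<dots>, p - 1\<close>.
  An inbox lists what a server receives in one round, separately for each sender.\<close>

type_synonym fact = "nat \<times> tuple"
type_synonym inbox = "nat \<Rightarrow> bool list"

text \<open>The shared randomness: a sequence of random hash functions on values, \<open>\<omega> j a\<close> being the
  \<open>j\<close>-th one applied to \<open>a\<close>. Their joint distribution is chosen by the algorithm and arbitrary
  (any discrete random object can be encoded), but independent of the data beyond the statistics.\<close>

type_synonym seed = "nat \<Rightarrow> nat \<Rightarrow> nat"

text \<open>What a server sends (to each destination) and what it finally outputs may depend in an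
  arbitrary way on the shared randomness, its own identity, its initial part of the input and
  the inboxes of all earlier rounds, oldest first; in particular servers have unbounded memory, and
  the number of the current round is the length of the list of inboxes.\<close>

record protocol =
  rand :: "seed pmf"
  send :: "seed \<Rightarrow> nat \<Rightarrow> fact set \<Rightarrow> inbox list \<Rightarrow> nat \<Rightarrow> bool list"
  answer :: "seed \<Rightarrow> nat \<Rightarrow> fact set \<Rightarrow> inbox list \<Rightarrow> tuple set"

primrec history ::
  "protocol \<Rightarrow> nat \<Rightarrow> seed \<Rightarrow> (nat \<Rightarrow> fact set) \<Rightarrow> nat \<Rightarrow> nat \<Rightarrow> inbox list" where
  "history P p \<omega> D 0 = (\<lambda>s. [])"
| "history P p \<omega> D (Suc r) = (\<lambda>s. history P p \<omega> D r s @
     [\<lambda>s'. if s' < p then send P \<omega> s' (D s') (history P p \<omega> D r s') s else []])"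

text \<open>Rounds are numbered from \<open>0\<close>.\<close>

definition bits_received ::
  "protocol \<Rightarrow> nat \<Rightarrow> seed \<Rightarrow> (nat \<Rightarrow> fact set) \<Rightarrow> nat \<Rightarrow> nat \<Rightarrow> nat" where
  "bits_received P p \<omega> D r s = (\<Sum>s'<p. length ((history P p \<omega> D (Suc r) s ! r) s'))"

definition mpc_load :: "protocol \<Rightarrow> nat \<Rightarrow> nat \<Rightarrow> seed \<Rightarrow> (nat \<Rightarrow> fact set) \<Rightarrow> nat" where
  "mpc_load P p rounds \<omega> D = Max {bits_received P p \<omega> D r s | r s. r < rounds \<and> s < p}"

definition mpc_result :: "protocol \<Rightarrow> nat \<Rightarrow> nat \<Rightarrow> seed \<Rightarrow> (nat \<Rightarrow> fact set) \<Rightarrow> tuple set" where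
  "mpc_result P p rounds \<omega> D = (\<Union>s<p. answer P \<omega> s (D s) (history P p \<omega> D rounds s))"

text \<open>The \<open>k * m\<close> input facts are distributed (adversarially) over the servers. The bound
  on the parts is met both if each single relation and if only the input as a whole is split as
  evenly as possible.\<close>

definition even_partition ::
  "nat \<Rightarrow> nat \<Rightarrow> nat \<Rightarrow> (nat \<Rightarrow> tuple set) \<Rightarrow> (nat \<Rightarrow> fact set) \<Rightarrow> bool" where
  "even_partition k p m S D \<longleftrightarrow>
     (\<Union>s<p. D s) = (SIGMA i:{1..k}. S i) \<and>
     (\<forall>s<p. \<forall>s'<p. s \<noteq> s' \<longrightarrow> D s \<inter> D s' = {}) \<and>
     (\<forall>s<p. int (card (D s)) \<le> int k * \<lceil>real m / real p\<rceil>)"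

end

theory Submission
  imports Defs
begin

text \<open>Let \<open>V\<^sub>i\<close> be the variables of \<open>S\<^sub>i\<close> and \<open>q\<close> the integer part of \<open>p\<^bsup>1/k\<^esup>\<close>. Call a
  partial tuple \<open>h\<close> heavy in \<open>S\<^sub>i\<close> if its frequency there exceeds \<open>m / q\<^bsup>|dom h|\<^esup>\<close>;
  the statistics list all of these.

  An answer without heavy restrictions is found in round one by hashing the variables onto a
  \<open>q \<times> \<dots> \<times> q\<close> grid of servers. Revealing the hash functions one variable at a time, a Chernoff
  bound loses a factor \<open>O(log p)\<close> per variable over the average number of tuples in a grid cell.

  Any other answer \<open>x\<close> has a minimal heavy restriction \<open>x|U\<close>. For \<open>j \<in> U\<close>, minimality leaves only
  \<open>O(q)\<close> possible values of \<open>x\<^sub>j\<close> once \<open>t = x|V\<^sub>j\<close> is known. Hence the server that initially holds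
  \<open>t\<close> can list all candidates for \<open>x\<close>, and for each \<open>i \<noteq> j\<close> it asks in round one whether
  \<open>u = x|V\<^sub>i\<close> belongs to \<open>S\<^sub>i\<close>. The question goes to a server chosen by hashing \<open>(i, u)\<close>, where
  every fact is stored in the same round; the reply comes back in round two. These are \<open>O(m q)\<close>
  questions and, up to logarithms, \<open>m q / p \<le> m / p\<^bsup>1 - 1/k\<^esup>\<close> per server. Hashing balances
  them provided that no single \<open>u\<close> is asked for too often. This fails only if the restriction
  of \<open>t\<close> to \<open>V\<^sub>i\<close> has frequency at least \<open>m / p\<close> in \<open>S\<^sub>j\<close>; but then \<open>u\<close> is one of \<open>O(p\<^sup>2)\<close> tuples
  known from the statistics, and these are broadcast.\<close>

section \<open>Random hashing\<close>

text \<open>Chernoff argument with exponential moments at scale \<open>1 / B\<close>: as each weight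
  is at most \<open>B\<close>, an item contributes a factor at most
  \<open>exp (2 * w a / (B * q))\<close>. The total weight makes the product at most
  \<open>exp 2\<close>, and Markov's inequality against \<open>exp K\<close> finishes.\<close>

lemma prob_hash_bucket:
  fixes w :: "'a \<Rightarrow> real" and q b d :: nat
  assumes fin: "finite A" and q: "q > 0" and B: "B > 0"
    and w: "\<And>a. a \<in> A \<Longrightarrow> 0 \<le> w a" "\<And>a. a \<in> A \<Longrightarrow> w a \<le> B"
    and total: "sum w A \<le> real q * B"
  shows "measure_pmf.prob (Pi_pmf A d (\<lambda>_. pmf_of_set {..<q}))
           {f. K * B < (\<Sum>a | a \<in> A \<and> f a = b. w a)} \<le> exp (2 - K)"
proof -
  let ?U = "pmf_of_set {..<q}"
  let ?P = "Pi_pmf A d (\<lambda>_. ?U)"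
  let ?g = "\<lambda>a y. exp (of_bool (y = b) * (w a / B))"
  let ?G = "\<lambda>f. \<Prod>a\<in>A. ?g a (f a)"
  have fin_int: "integrable (measure_pmf ?U) h" for h :: "nat \<Rightarrow> real"
    by (rule integrable_measure_pmf_finite) (use q in \<open>simp add: set_pmf_of_set lessThan_empty_iff\<close>)
  have one: "measure_pmf.expectation ?U (?g a) \<le> exp (2 * w a / (B * real q))" if a: "a \<in> A" for a
  proof -
    define v where "v = w a / B"
    have v: "0 \<le> v" "v \<le> 1" using w[OF a] B by (auto simp: v_def)
    have "exp v \<le> 1 + v + v\<^sup>2" using v by (intro exp_bound) auto
    also have "\<dots> \<le> 1 + 2 * v" using v by (simp add: power2_eq_square mult_left_le)
    finally have ev: "exp v \<le> 1 + 2 * v" .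
    have "measure_pmf.expectation ?U (?g a) = (\<Sum>y<q. ?g a y) / real q"
      using q by (subst integral_pmf_of_set) (auto simp: lessThan_empty_iff)
    also have "\<dots> \<le> (\<Sum>y<q. 1 + of_bool (y = b) * (2 * v)) / real q"
      using ev by (intro divide_right_mono sum_mono) (auto simp: v_def[symmetric])
    also have "\<dots> = (real q + (\<Sum>y<q. of_bool (y = b)) * (2 * v)) / real q"
      by (simp add: sum.distrib sum_distrib_right)
    \<comment> \<open>Only an inequality, since \<open>b\<close> may lie outside the range of the
      hash function.\<close>
    also have "\<dots> \<le> (real q + 1 * (2 * v)) / real q"
      using v by (intro divide_right_mono add_mono mult_right_mono) (auto simp: of_bool_def)
    also have "\<dots> = 1 + 2 * v / real q" using q by (simp add: field_simps)
    also have "\<dots> \<le> exp (2 * v / real q)" by simp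
    finally show ?thesis by (simp add: v_def field_simps)
  qed
  have "measure_pmf.expectation ?P ?G = (\<Prod>a\<in>A. measure_pmf.expectation ?U (?g a))"
    using fin fin_int by (intro expectation_prod_Pi_pmf) auto
  also have "\<dots> \<le> (\<Prod>a\<in>A. exp (2 * w a / (B * real q)))"
    using one by (intro prod_mono) (auto intro: integral_nonneg)
  also have "\<dots> = exp (2 * (sum w A / (B * real q)))"
    using fin by (simp add: exp_sum[symmetric] sum_divide_distrib sum_distrib_left)
  also have "\<dots> \<le> exp 2" using total B q by (simp add: field_simps)
  finally have E: "measure_pmf.expectation ?P ?G \<le> exp 2" .
  have "measure_pmf.prob ?P {f. K * B < (\<Sum>a | a \<in> A \<and> f a = b. w a)}
      \<le> measure_pmf.prob ?P {f. exp K \<le> ?G f}"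
  proof (rule measure_pmf.finite_measure_mono)
    show "{f. K * B < (\<Sum>a | a \<in> A \<and> f a = b. w a)} \<subseteq> {f. exp K \<le> ?G f}"
    proof safe
      fix f assume f: "K * B < (\<Sum>a | a \<in> A \<and> f a = b. w a)"
      have "(\<Sum>a | a \<in> A \<and> f a = b. w a) = (\<Sum>a\<in>A. of_bool (f a = b) * w a)"
        using fin by (intro sum.mono_neutral_cong_left) auto
      also have "\<dots> = (\<Sum>a\<in>A. of_bool (f a = b) * (w a / B)) * B"
        using B by (simp add: sum_distrib_right)
      finally have "K < (\<Sum>a\<in>A. of_bool (f a = b) * (w a / B))" using f B by simp
      then show "exp K \<le> ?G f" using fin by (simp add: exp_sum[symmetric])
    qed
  qed simp
  also have "\<dots> = measure_pmf.prob ?P {f \<in> space (measure_pmf ?P). exp K \<le> ?G f}" by simp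
  also have "\<dots> \<le> measure_pmf.expectation ?P ?G / exp K"
    using fin fin_int
    by (intro integral_Markov_inequality_measure[where A = "{}"] integrable_prod_Pi_pmf)
       (auto intro!: AE_pmfI prod_nonneg)
  also have "\<dots> \<le> exp 2 / exp K" using E by (intro divide_right_mono) auto
  finally show ?thesis by (simp add: exp_diff)
qed

text \<open>The rows of the seed are independent, so all rows except \<open>z\<close> can be drawn
  first. A bound on row \<open>z\<close> that is uniform in the others then survives averaging over
  them.\<close>

lemma prob_Pi_pmf_resample:
  assumes J: "finite J" "z \<in> J"
    and row: "\<And>f. measure_pmf.prob (P z) {r. E (f(z := r))} \<le> \<delta>"
  shows "measure_pmf.prob (Pi_pmf J d P) {\<omega>. E \<omega>} \<le> \<delta>"
proof -
  have \<delta>: "\<delta> \<ge> 0" using order_trans[OF measure_nonneg row] .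
  have "Pi_pmf J d P = Pi_pmf (insert z (J - {z})) d P" using J by (simp add: insert_absorb)
  also have "\<dots> = do {y \<leftarrow> P z; f \<leftarrow> Pi_pmf (J - {z}) d P; return_pmf (f(z := y))}"
    using J by (intro Pi_pmf_insert') auto
  also have "\<dots> = do {f \<leftarrow> Pi_pmf (J - {z}) d P; y \<leftarrow> P z; return_pmf (f(z := y))}"
    by (rule bind_commute_pmf)
  also have "\<dots> = do {f \<leftarrow> Pi_pmf (J - {z}) d P; map_pmf (\<lambda>y. f(z := y)) (P z)}"
    by (simp add: map_pmf_def)
  finally have eq: "Pi_pmf J d P = do {f \<leftarrow> Pi_pmf (J - {z}) d P; map_pmf (\<lambda>y. f(z := y)) (P z)}" .
  have "emeasure (Pi_pmf J d P) {\<omega>. E \<omega>}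
      = (\<integral>\<^sup>+f. emeasure (P z) {r. E (f(z := r))} \<partial>Pi_pmf (J - {z}) d P)"
    by (simp add: eq vimage_def)
  also have "\<dots> \<le> (\<integral>\<^sup>+f. ennreal \<delta> \<partial>Pi_pmf (J - {z}) d P)"
    using row by (intro nn_integral_mono) (simp add: measure_pmf.emeasure_eq_measure ennreal_leI)
  also have "\<dots> = ennreal \<delta>" by simp
  finally show ?thesis using \<delta> by (simp add: measure_pmf.emeasure_eq_measure)
qed

lemma prob_pmf_union_bound:
  assumes "finite I" "\<And>i. i \<in> I \<Longrightarrow> measure_pmf.prob P {\<omega>. E i \<omega>} \<le> \<delta> i"
  shows "measure_pmf.prob P {\<omega>. \<exists>i\<in>I. E i \<omega>} \<le> sum \<delta> I"
proof -
  have "{\<omega>. \<exists>i\<in>I. E i \<omega>} = (\<Union>i\<in>I. {\<omega>. E i \<omega>})" by auto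
  then have "measure_pmf.prob P {\<omega>. \<exists>i\<in>I. E i \<omega>} \<le> (\<Sum>i\<in>I. measure_pmf.prob P {\<omega>. E i \<omega>})"
    using assms(1) by (simp add: measure_pmf.finite_measure_subadditive_finite)
  also have "\<dots> \<le> sum \<delta> I" using assms(2) by (rule sum_mono)
  finally show ?thesis .
qed

section \<open>Counting frequent partial tuples\<close>

text \<open>Two different partial tuples with the same domain have no common extension, so the sets
  counted by their frequencies are disjoint.\<close>

lemma frequency_sum_le:
  assumes "finite R" "\<And>h. h \<in> G \<Longrightarrow> dom h = U" "finite G"
  shows "(\<Sum>h\<in>G. frequency R h) \<le> card R"
proof -
  have "h = h'" if "h \<in> G" "h' \<in> G" "h \<subseteq>\<^sub>m t" "h' \<subseteq>\<^sub>m t" for h h' and t :: tuple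
    using assms(2)[OF that(1)] assms(2)[OF that(2)] that(3,4)
    by (metis map_le_def map_le_antisym)
  then have "(\<Sum>h\<in>G. frequency R h) = card (\<Union>h\<in>G. {t \<in> R. h \<subseteq>\<^sub>m t})"
    unfolding frequency_def using assms by (subst card_UN_disjoint) auto
  also have "\<dots> \<le> card R" using assms(1) by (intro card_mono) auto
  finally show ?thesis .
qed

lemma frequency_mono: "finite R \<Longrightarrow> L \<subseteq> R \<Longrightarrow> frequency L h \<le> frequency R h"
  unfolding frequency_def by (intro card_mono) auto

lemma map_le_iff_restrict: "h \<subseteq>\<^sub>m t \<longleftrightarrow> h = t |` dom h"
  by (auto simp: map_le_def restrict_map_def fun_eq_iff dom_def)

text \<open>Double counting through the previous disjointness. With \<open>card R \<le> m\<close> it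
  yields at most \<open>p\<close> frequent partial tuples per domain. Positivity of \<open>m\<close>
  ensures that each of them occurs in \<open>R\<close>, which gives finiteness.\<close>

lemma card_frequent:
  fixes p :: nat and U :: "nat set"
  assumes R: "finite R" and m: "m > (0 :: nat)"
  defines "G \<equiv> {h. dom h = U \<and> m \<le> frequency R h * p}"
  shows "finite G" "m * card G \<le> card R * p"
proof -
  have "h \<in> (\<lambda>t. t |` U) ` R" if "h \<in> G" for h
  proof -
    have "frequency R h \<noteq> 0" using that m by (cases "frequency R h") (auto simp: G_def)
    then obtain t where "t \<in> R" "h \<subseteq>\<^sub>m t" using R by (auto simp: frequency_def)
    then show ?thesis using that by (auto simp: G_def map_le_iff_restrict)
  qed
  then show fin: "finite G" using R by (meson finite_imageI finite_subset subsetI)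
  have "m * card G = (\<Sum>h\<in>G. m)" by simp
  also have "\<dots> \<le> (\<Sum>h\<in>G. frequency R h * p)" by (rule sum_mono) (simp add: G_def)
  also have "\<dots> = (\<Sum>h\<in>G. frequency R h) * p" by (simp add: sum_distrib_right)
  also have "\<dots> \<le> card R * p"
    using R fin by (intro mult_right_mono frequency_sum_le) (auto simp: G_def)
  finally show "m * card G \<le> card R * p" .
qed

text \<open>The union bound ranges over those partial tuples \<open>h\<close> only whose frequency is at least \<open>m / p\<close>:
  for all others the claimed bound is trivial. This keeps the failure probability
  polynomial in \<open>p\<close>, independently of \<open>m\<close> and \<open>n\<close>.\<close>

lemma hypercube_load:
  fixes L :: "tuple set" and g :: "nat \<Rightarrow> nat \<Rightarrow> nat" and K :: real and m n p q :: nat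
    and P :: "nat \<Rightarrow> (nat \<Rightarrow> nat) pmf"
  assumes V: "finite V" and L: "finite L" "\<And>t. t \<in> L \<Longrightarrow> dom t = V \<and> ran t \<subseteq> {1..n}"
    and pos: "m > 0" "q > 0" "p > 0" and qp: "q ^ card V \<le> p" and K: "K \<ge> 1"
    and light: "\<And>h. dom h \<subseteq> V \<Longrightarrow> frequency L h * q ^ card (dom h) \<le> m"
    and J: "finite J" "V \<subseteq> J"
    and P: "\<And>z. z \<in> V \<Longrightarrow> P z = Pi_pmf {1..n} 0 (\<lambda>_. pmf_of_set {..<q})"
  shows "measure_pmf.prob (Pi_pmf J d P)
      {\<omega>. \<exists>s<p. K ^ card V * m / q ^ card V < card {t \<in> L. \<forall>z\<in>V. \<omega> z (the (t z)) = g s z}}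
    \<le> card V * (2 ^ card V * p * p * exp (2 - K))"
proof -
  let ?Q = "Pi_pmf J d P"
  define \<delta> where "\<delta> = 2 ^ card V * p * p * exp (2 - K)"
  define N where "N Z \<omega> h s = card {t \<in> L. h \<subseteq>\<^sub>m t \<and> (\<forall>z\<in>Z. \<omega> z (the (t z)) = g s z)}"
    for Z and \<omega> :: seed and h s
  \<comment> \<open>The invariant behind revealing one hash function at a time: after the variables
    in \<open>Z\<close>, the part of a cell extending \<open>h\<close> exceeds its ideal share by at
    most \<open>K ^ card Z\<close>. For \<open>Z = {}\<close> this is the lightness assumption; for
    \<open>Z = V\<close> and empty \<open>h\<close> it is the claim.\<close>
  define bad where "bad Z \<omega> \<longleftrightarrow> (\<exists>h s. dom h \<subseteq> V - Z \<and> s < p \<and>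
      K ^ card Z * m / q ^ (card (dom h) + card Z) < N Z \<omega> h s)" for Z \<omega>
  have card_L: "card L \<le> m" using light[of "Map.empty"] by (simp add: frequency_def)
  have step: "measure_pmf.prob ?Q {\<omega>. \<not> bad Z \<omega> \<and> bad (insert z Z) \<omega>} \<le> \<delta>"
    if Z: "insert z Z \<subseteq> V" "z \<notin> Z" for z Z
  proof (rule prob_Pi_pmf_resample[OF J(1)])
    show "z \<in> J" using Z J by auto
    have finZ: "finite Z" using Z V by (auto intro: finite_subset)
    have z: "z \<in> V" using Z by auto
    fix f :: seed
    \<comment> \<open>Counts for \<open>Z\<close> ignore row \<open>z\<close>, so whether the
      invariant held before is settled by \<open>f\<close> alone and only the new row is
      random.\<close>
    have N_upd: "N Z (f(z := r)) = N Z f" for r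
      using Z(2) unfolding N_def by (intro ext arg_cong[where f = card]) (auto split: if_splits)
    then have bad_upd: "bad Z (f(z := r)) = bad Z f" for r by (simp add: bad_def)
    show "measure_pmf.prob (P z) {r. \<not> bad Z (f(z := r)) \<and> bad (insert z Z) (f(z := r))} \<le> \<delta>"
    proof (cases "bad Z f")
      case True
      then show ?thesis by (simp add: bad_upd \<delta>_def)
    next
      case False
      define G where "G = {h. dom h \<subseteq> V - insert z Z \<and> m \<le> frequency L h * p}"
      define G' where "G' U = {h. dom h = U \<and> m \<le> frequency L h * p}" for U
      have G': "finite (G' U) \<and> card (G' U) \<le> p" for U
      proof -
        have "m * card (G' U) \<le> m * p"
          using card_frequent(2)[OF L(1) pos(1), of U p] card_L mult_le_mono1[OF card_L, of p]
          unfolding G'_def by linarith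
        then show ?thesis
          using card_frequent(1)[OF L(1) pos(1), of U p] pos(1) by (auto simp: G'_def)
      qed
      have "G \<subseteq> (\<Union>U\<in>Pow V. G' U)" by (auto simp: G_def G'_def)
      then have "finite G" "card G \<le> card (\<Union>U\<in>Pow V. G' U)"
        using V G' by (auto intro!: card_mono intro: finite_subset)
      moreover have "card (\<Union>U\<in>Pow V. G' U) \<le> (\<Sum>U\<in>Pow V. p)"
        using V G' by (intro order_trans[OF card_UN_le] sum_mono) auto
      ultimately have G: "finite G" "card G \<le> 2 ^ card V * p" using V by (auto simp: card_Pow)
      \<comment> \<open>This is what the invariant for \<open>Z\<close> grants to
        \<open>h(z \<mapsto> a)\<close>, hence the \<open>+ 1\<close>. It caps each bucket item, and
        the invariant for \<open>h\<close> itself caps their total by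
        \<open>q * B h\<close>.\<close>
      define B where "B h = K ^ card Z * m / q ^ (card (dom h) + 1 + card Z)" for h :: tuple
      define w where "w h s a = real (N Z f (h(z \<mapsto> a)) s)" for h s a
      define E where "E x r \<longleftrightarrow> (case x of (h, s) \<Rightarrow>
          K * B h < (\<Sum>a | a \<in> {1..n} \<and> r a = g s z. w h s a))" for x and r :: "nat \<Rightarrow> nat"
      have tail: "measure_pmf.prob (P z) {r. E x r} \<le> exp (2 - K)" if x: "x \<in> G \<times> {..<p}" for x
      proof -
        obtain h s where hs: "x = (h, s)" "h \<in> G" "s < p" using x by auto
        have dom_h: "dom h \<subseteq> V - insert z Z" using hs by (simp add: G_def)
        have fin_h: "finite (dom h)" using dom_h V by (auto intro: finite_subset)
        show ?thesis unfolding E_def hs prod.case P[OF z]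
        proof (rule prob_hash_bucket)
          show "B h > 0" using K pos by (simp add: B_def)
          show "w h s a \<le> B h" for a
          proof -
            have "dom (h(z \<mapsto> a)) \<subseteq> V - Z" using dom_h Z by auto
            moreover have "card (dom (h(z \<mapsto> a))) = card (dom h) + 1"
              using dom_h fin_h by (subst dom_fun_upd) (auto simp: card_insert_if)
            ultimately show ?thesis using False hs(3) unfolding bad_def w_def B_def
              by (metis not_less)
          qed
          have "sum (w h s) {1..n} = real (\<Sum>a\<in>{1..n}. N Z f (h(z \<mapsto> a)) s)" by (simp add: w_def)
          also have "(\<Sum>a\<in>{1..n}. N Z f (h(z \<mapsto> a)) s) =
              card (\<Union>a\<in>{1..n}. {t \<in> L. h(z \<mapsto> a) \<subseteq>\<^sub>m t \<and> (\<forall>z\<in>Z. f z (the (t z)) = g s z)})"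
            unfolding N_def using L(1)
            by (intro card_UN_disjoint[symmetric]) (auto simp: map_le_def dest: sym)
          also have "\<dots> \<le> N Z f h s" unfolding N_def using L(1) dom_h
            by (intro card_mono) (auto simp: map_le_def split: if_splits)
          also have "real (N Z f h s) \<le> K ^ card Z * m / q ^ (card (dom h) + card Z)"
          proof -
            have "dom h \<subseteq> V - Z" using dom_h by auto
            then show ?thesis using False hs(3) unfolding bad_def by (meson not_less)
          qed
          also have "\<dots> = real q * B h" using pos by (simp add: B_def field_simps)
          finally show "sum (w h s) {1..n} \<le> real q * B h" by simp
        qed (use pos in \<open>auto simp: w_def\<close>)
      qed
      have sub: "\<exists>x\<in>G \<times> {..<p}. E x r" if r: "bad (insert z Z) (f(z := r))" for r
      proof -
        obtain h s where hs: "dom h \<subseteq> V - insert z Z" "s < p"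
          "K ^ card (insert z Z) * m / q ^ (card (dom h) + card (insert z Z)) < N (insert z Z) (f(z := r)) h s"
          using r unfolding bad_def by blast
        have cZ: "card (insert z Z) = card Z + 1" using finZ Z by simp
        have "card (dom h) + card (insert z Z) \<le> card (V - insert z Z) + card (insert z Z)"
          using hs(1) V by (intro add_right_mono card_mono) auto
        also have "\<dots> = card V" using Z V
          by (metis add.commute card_Diff_subset card_mono finite_subset le_add_diff_inverse)
        finally have "q ^ (card (dom h) + card (insert z Z)) \<le> q ^ card V"
          using pos by (intro power_increasing) auto
        then have qp': "q ^ (card (dom h) + card (insert z Z)) \<le> p" using qp by simp
        \<comment> \<open>A violation forces a frequency of at least \<open>m / p\<close>, because
          the power of \<open>q\<close> involved is at most \<open>p\<close>. So only the partial
          tuples in \<open>G\<close> can violate the bound.\<close>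
        have "m \<le> frequency L h * p"
        proof -
          have "m / p \<le> m / q ^ (card (dom h) + card (insert z Z))"
            using qp' pos by (intro divide_left_mono) (auto simp flip: of_nat_power)
          also have "\<dots> \<le> K ^ card (insert z Z) * m / q ^ (card (dom h) + card (insert z Z))"
            using K by (intro divide_right_mono) (auto simp: mult_le_cancel_right1)
          also have "\<dots> < N (insert z Z) (f(z := r)) h s" by (rule hs)
          also have "\<dots> \<le> frequency L h"
            unfolding N_def frequency_def using L(1) by (auto intro: card_mono)
          finally have "real m \<le> real (frequency L h * p)" using pos by (simp add: field_simps)
          then show ?thesis by linarith
        qed
        then have "h \<in> G" using hs by (simp add: G_def)
        moreover have "E (h, s) r"
        proof -
          \<comment> \<open>Splitting by the value \<open>a\<close> at \<open>z\<close> turns the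
            new count into the weight of a single hash bucket.\<close>
          have "{t \<in> L. h \<subseteq>\<^sub>m t \<and> (\<forall>x\<in>insert z Z. (f(z := r)) x (the (t x)) = g s x)}
            \<subseteq> (\<Union>a\<in>{a \<in> {1..n}. r a = g s z}.
                 {t \<in> L. h(z \<mapsto> a) \<subseteq>\<^sub>m t \<and> (\<forall>x\<in>Z. f x (the (t x)) = g s x)})" (is "?A \<subseteq> ?B")
          proof
            fix t assume t: "t \<in> ?A"
            then have "z \<in> dom t" "ran t \<subseteq> {1..n}" using L(2) z by auto
            then obtain a where a: "t z = Some a" "a \<in> {1..n}" by (auto simp: ran_def)
            then show "t \<in> ?B" using t Z(2) by (auto simp: map_le_def split: if_splits)
          qed
          then have "N (insert z Z) (f(z := r)) h s \<le> card ?B"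
            unfolding N_def using L(1) by (intro card_mono) auto
          also have "\<dots> \<le> (\<Sum>a | a \<in> {1..n} \<and> r a = g s z. N Z f (h(z \<mapsto> a)) s)"
            unfolding N_def by (rule card_UN_le) auto
          finally have "real (N (insert z Z) (f(z := r)) h s)
              \<le> (\<Sum>a | a \<in> {1..n} \<and> r a = g s z. w h s a)"
            unfolding w_def by (simp only: of_nat_sum[symmetric] of_nat_le_iff)
          then show ?thesis using hs(3) unfolding E_def cZ B_def by (simp add: mult.assoc)
        qed
        ultimately show ?thesis using hs(2) by auto
      qed
      have "measure_pmf.prob (P z) {r. \<not> bad Z (f(z := r)) \<and> bad (insert z Z) (f(z := r))}
          \<le> measure_pmf.prob (P z) {r. \<exists>x\<in>G \<times> {..<p}. E x r}"
        using sub by (intro measure_pmf.finite_measure_mono) auto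
      also have "\<dots> \<le> (\<Sum>x\<in>G \<times> {..<p}. exp (2 - K))"
        using G tail by (intro prob_pmf_union_bound) auto
      also have "\<dots> = real (card G * p) * exp (2 - K)" by (simp add: card_cartesian_product)
      also have "\<dots> \<le> real (2 ^ card V * p * p) * exp (2 - K)"
        using G(2) by (intro mult_right_mono) (auto simp del: of_nat_mult)
      finally show ?thesis by (simp add: \<delta>_def)
    qed
  qed
  have "measure_pmf.prob ?Q {\<omega>. bad Z \<omega>} \<le> card Z * \<delta>" if "Z \<subseteq> V" for Z
    using finite_subset[OF that V] that
  proof (induction rule: finite_induct)
    case empty
    have "\<not> bad {} \<omega>" for \<omega>
    proof
      assume "bad {} \<omega>"
      then obtain h where h: "dom h \<subseteq> V" "m / q ^ card (dom h) < frequency L h"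
        by (auto simp: bad_def N_def frequency_def)
      then have "real m < real (frequency L h * q ^ card (dom h))"
        using pos by (simp add: field_simps)
      then show False using light[OF h(1)] by linarith
    qed
    then show ?case by simp
  next
    case (insert z Z)
    have "measure_pmf.prob ?Q {\<omega>. bad (insert z Z) \<omega>}
        \<le> measure_pmf.prob ?Q ({\<omega>. bad Z \<omega>} \<union> {\<omega>. \<not> bad Z \<omega> \<and> bad (insert z Z) \<omega>})"
      by (intro measure_pmf.finite_measure_mono) auto
    also have "\<dots> \<le> measure_pmf.prob ?Q {\<omega>. bad Z \<omega>}
        + measure_pmf.prob ?Q {\<omega>. \<not> bad Z \<omega> \<and> bad (insert z Z) \<omega>}"
      by (intro measure_Un_le) auto
    also have "\<dots> \<le> card Z * \<delta> + \<delta>" using insert step by (intro add_mono) auto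
    finally show ?case using insert by (simp add: algebra_simps)
  qed
  from this[of V] have "measure_pmf.prob ?Q {\<omega>. bad V \<omega>} \<le> card V * \<delta>" by simp
  moreover have "bad V \<omega>" if "s < p"
    "K ^ card V * m / q ^ card V < card {t \<in> L. \<forall>z\<in>V. \<omega> z (the (t z)) = g s z}" for \<omega> s
    unfolding bad_def N_def using that by (intro exI[of _ "Map.empty"] exI[of _ s]) simp
  then have "{\<omega>. \<exists>s<p. K ^ card V * m / q ^ card V < card {t \<in> L. \<forall>z\<in>V. \<omega> z (the (t z)) = g s z}}
      \<subseteq> {\<omega>. bad V \<omega>}" by auto
  ultimately show ?thesis unfolding \<delta>_def
    by - (rule order_trans[OF measure_pmf.finite_measure_mono], assumption, simp, assumption)
qed

section \<open>Encoding sets of facts\<close>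

text \<open>Messages are encoded as whole sets, with bits charged per element. In particular the
  empty set must be sent as the empty message.\<close>

definition encodes :: "'a set \<Rightarrow> nat \<Rightarrow> ('a set \<Rightarrow> bool list) \<Rightarrow> bool" where
  "encodes A b e \<longleftrightarrow> inj_on e (Pow A) \<and> (\<forall>X\<subseteq>A. length (e X) \<le> b * card X)"

text \<open>Every element gets a codeword of exactly \<open>b\<close> bits, and a set is sent as the
  concatenation in some fixed order. No separators are needed: as \<open>b > 0\<close>, the length
  reveals the number of codewords.\<close>

lemma ex_encodes:
  assumes A: "finite A" "card A \<le> 2 ^ b" and b: "b > 0"
  shows "\<exists>e. encodes A b e"
proof -
  let ?W = "{bs :: bool list. length bs = b}"
  have W: "finite ?W" "card ?W = 2 ^ b"
    using finite_lists_length_eq[of "UNIV :: bool set" b] card_lists_length_eq[of "UNIV :: bool set" b]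
    by auto
  then obtain c where c: "inj_on c A" "c ` A \<subseteq> ?W"
    using A card_le_inj[of A ?W] by auto
  define l where "l X = (SOME xs. set xs = X \<and> distinct xs)" for X :: "'a set"
  have l: "set (l X) = X" "distinct (l X)" if "X \<subseteq> A" for X
    using someI_ex[OF finite_distinct_list[OF finite_subset[OF that A(1)]]] by (auto simp: l_def)
  define e where "e X = concat (map c (l X))" for X
  have len: "length (e X) = b * card X" if X: "X \<subseteq> A" for X
  proof -
    have "map (length \<circ> c) (l X) = map (\<lambda>_. b) (l X)" using l(1)[OF X] X c(2) by auto
    then have "length (e X) = sum_list (map (\<lambda>_. b) (l X))"
      by (simp only: e_def length_concat map_map)
    then have "length (e X) = b * length (l X)" by (simp add: sum_list_triv mult.commute)
    then show ?thesis using l[OF X] by (metis distinct_card)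
  qed
  have "inj_on e (Pow A)"
  proof (rule inj_onI)
    fix X Y assume XY: "X \<in> Pow A" "Y \<in> Pow A" "e X = e Y"
    then have "card X = card Y" using len[of X] len[of Y] b by auto
    then have "length (l X) = length (l Y)" using XY l by (metis PowD distinct_card)
    moreover have "length x = b" if "x \<in> set (map c (l Z))" "Z \<subseteq> A" for x Z
      using that c(2) l(1) by auto
    then have "length x = length y" if "(x, y) \<in> set (zip (map c (l X)) (map c (l Y)))" for x y
      using set_zip_leftD[OF that] set_zip_rightD[OF that] XY(1,2) by (metis PowD)
    then have "\<forall>(x, y)\<in>set (zip (map c (l X)) (map c (l Y))). length x = length y" by blast
    ultimately have "map c (l X) = map c (l Y)"
      using XY(3) by (intro concat_injective) (auto simp: e_def)
    then have "c ` X = c ` Y" using l XY by (metis PowD set_map)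
    then show "X = Y" using c(1) XY by (simp add: inj_on_image_eq_iff)
  qed
  then show ?thesis using len unfolding encodes_def by auto
qed

section \<open>Counting tuples over a finite domain\<close>

definition tuples :: "nat set \<Rightarrow> nat \<Rightarrow> tuple set" where
  "tuples V n = {t. dom t = V \<and> ran t \<subseteq> {1..n}}"

lemma finite_tuples [simp]: "finite V \<Longrightarrow> finite (tuples V n)"
  unfolding tuples_def by (rule finite_set_of_finite_maps) auto

lemma card_tuples_le:
  assumes "finite V"
  shows "card (tuples V n) \<le> n ^ card V"
proof -
  have "card (tuples V n) \<le> card (V \<rightarrow>\<^sub>E {1..n})"
  proof (rule card_inj_on_le[where f = "\<lambda>t. restrict (\<lambda>z. the (t z)) V"])
    show "inj_on (\<lambda>t. restrict (\<lambda>z. the (t z)) V) (tuples V n)"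
    proof (rule inj_onI, rule ext)
      fix t u z
      assume t: "t \<in> tuples V n" and u: "u \<in> tuples V n"
        and eq: "restrict (\<lambda>z. the (t z)) V = restrict (\<lambda>z. the (u z)) V"
      show "t z = u z"
      proof (cases "z \<in> V")
        case True
        then have "the (t z) = the (u z)" using fun_cong[OF eq, of z] by simp
        moreover have "z \<in> dom t" "z \<in> dom u" using True t u by (auto simp: tuples_def)
        ultimately show ?thesis by auto
      next
        case False
        then have "z \<notin> dom t" "z \<notin> dom u" using t u by (auto simp: tuples_def)
        then show ?thesis by (simp add: domIff)
      qed
    qed
    show "(\<lambda>t. restrict (\<lambda>z. the (t z)) V) ` tuples V n \<subseteq> V \<rightarrow>\<^sub>E {1..n}"
    proof (intro image_subsetI PiE_I)
      fix t z assume "t \<in> tuples V n" "z \<in> V"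
      then have "z \<in> dom t" "ran t \<subseteq> {1..n}" by (auto simp: tuples_def)
      then show "restrict (\<lambda>z. the (t z)) V z \<in> {1..n}" using \<open>z \<in> V\<close> by (auto simp: ran_def)
    qed auto
    show "finite (V \<rightarrow>\<^sub>E {1..n})" using assms by (simp add: finite_PiE)
  qed
  then show ?thesis using assms by (simp add: card_PiE)
qed

lemma lw_join_mono:
  assumes "\<And>i. i \<in> {1..k} \<Longrightarrow> R i \<subseteq> R' i"
  shows "lw_join k R \<subseteq> lw_join k R'"
  using assms unfolding lw_join_def natural_join_def by blast

section \<open>The protocol\<close>

text \<open>The parameters are exactly what the algorithm may depend on. The relations and their
  partition enter only in the analysis, so the protocol cannot use data beyond the statistics
  \<open>H\<close>.\<close>

locale lw_protocol =
  fixes k p n m :: nat and H :: statistics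
begin

definition q :: nat where
  "q = nat \<lfloor>root k (real p)\<rfloor>"

definition width :: nat where
  "width = 2 * k * (nat \<lceil>log 2 (real n)\<rceil> + 1)"

definition facts :: "fact set" where
  "facts = (SIGMA i:{1..k}. tuples (lw_vars k i) n)"

definition encode :: "(bool \<times> fact) set \<Rightarrow> bool list" where
  "encode = (SOME e. encodes (UNIV \<times> facts) width e)"

definition decode :: "bool list \<Rightarrow> (bool \<times> fact) set" where
  "decode = inv_into (Pow (UNIV \<times> facts)) encode"

text \<open>Coordinates of the servers in the \<open>q ^ k\<close> grid. Only surjectivity is
  demanded; coordinates of surplus servers are arbitrary, which the load bound tolerates.\<close>

definition grid :: "nat \<Rightarrow> nat \<Rightarrow> nat" where
  "grid = (SOME g. \<forall>f \<in> {1..k} \<rightarrow> {..<q}. \<exists>s<p. \<forall>l\<in>{1..k}. g s l = f l)"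

text \<open>Seeds hash natural numbers, so facts are numbered injectively before being
  hashed.\<close>

definition key :: "fact \<Rightarrow> nat" where
  "key = (SOME f. inj_on f facts)"

text \<open>Read off the statistics only. The strict inequality keeps the empty partial tuple, whose
  frequency is \<open>m\<close>, from being heavy.\<close>

definition heavy :: "nat \<Rightarrow> tuple \<Rightarrow> bool" where
  "heavy i h \<longleftrightarrow> (\<exists>f. (i, h, f) \<in> H \<and> m < f * q ^ card (dom h))"

definition light :: "fact \<Rightarrow> bool" where
  "light y \<longleftrightarrow> (\<forall>U\<subseteq>lw_vars k (fst y). \<not> heavy (fst y) (snd y |` U))"

definition listed :: "nat \<Rightarrow> tuple \<Rightarrow> bool" where
  "listed i h \<longleftrightarrow> (\<exists>f. (i, h, f) \<in> H)"

text \<open>Minimality of a heavy restriction is relaxed to what concerns \<open>j\<close>: dropping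
  \<open>j\<close> must destroy heaviness. A server can evaluate this from \<open>t\<close> and the
  statistics, and it still leaves only \<open>O(q)\<close> values.\<close>

definition extensions :: "nat \<Rightarrow> tuple \<Rightarrow> nat set" where
  "extensions j t = {a. \<exists>i\<in>{1..k}. \<exists>U\<subseteq>lw_vars k i. j \<in> U \<and>
     \<not> heavy i (t |` (U - {j})) \<and> heavy i (t(j \<mapsto> a) |` U)}"

text \<open>These facts replace the questions that are suppressed because of a listed restriction; the
  second conjunct holds for the value at \<open>j\<close> of every candidate answer.\<close>

definition public :: "fact \<Rightarrow> bool" where
  "public y \<longleftrightarrow> (\<exists>j\<in>{1..k} - {fst y}. listed j (snd y |` lw_vars k j) \<and>
     (\<exists>l h. listed l h \<and> j \<in> dom h \<and> h j = snd y j))"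

text \<open>Three reasons to send a fact to \<open>s\<close>: its grid cell (light facts only, rows
  \<open>1\<close> to \<open>k\<close> of the seed), its home server for answering questions (row
  \<open>0\<close>), and the broadcast.\<close>

definition shipped :: "seed \<Rightarrow> fact set \<Rightarrow> nat \<Rightarrow> fact set" where
  "shipped \<omega> D s = {y \<in> D. light y \<and> (\<forall>l\<in>lw_vars k (fst y). \<omega> l (the (snd y l)) = grid s l)
     \<or> \<omega> 0 (key y) = s \<or> public y}"

text \<open>A triple \<open>((j, t), a, i)\<close> asks whether the candidate answer \<open>t(j \<mapsto> a)\<close> is consistent with the
  \<open>i\<close>-th relation.\<close>

definition questions :: "fact set \<Rightarrow> (fact \<times> nat \<times> nat) set" where
  "questions D = {((j, t), a, i) | j t a i. (j, t) \<in> D \<and> a \<in> extensions j t \<and> i \<in> {1..k} - {j}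
     \<and> \<not> listed j (t |` lw_vars k i)}"

definition target :: "fact \<times> nat \<times> nat \<Rightarrow> fact" where
  "target = (\<lambda>((j, t), a, i). (i, t(j \<mapsto> a) |` lw_vars k i))"

definition asked :: "seed \<Rightarrow> fact set \<Rightarrow> nat \<Rightarrow> fact set" where
  "asked \<omega> D s = {y \<in> target ` questions D. \<omega> 0 (key y) = s}"

text \<open>In a message, \<open>True\<close> marks a fact and \<open>False\<close> marks a question.\<close>

definition told :: "inbox \<Rightarrow> fact set" where
  "told I = {y. \<exists>s<p. (True, y) \<in> decode (I s)}"

text \<open>The empty list of inboxes signals round one. In round two a server returns the facts it
  was asked about and was told; silence means a negative reply. The output is the join of everything
  a server then knows.\<close>

definition prot :: protocol where
  "prot = \<lparr>
     rand = Pi_pmf {0..k} (\<lambda>_. 0) (\<lambda>l. if l = 0 then Pi_pmf (key ` facts) 0 (\<lambda>_. pmf_of_set {..<p})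
                                    else Pi_pmf {1..n} 0 (\<lambda>_. pmf_of_set {..<q})),
     send = (\<lambda>\<omega> s D Is s'. encode (case Is of
         [] \<Rightarrow> Pair True ` shipped \<omega> D s' \<union> Pair False ` asked \<omega> D s'
       | I # _ \<Rightarrow> Pair True ` ({y. (False, y) \<in> decode (I s')} \<inter> told I))),
     answer = (\<lambda>\<omega> s D Is. lw_join k (\<lambda>i. {u. (i, u) \<in> D \<or> (\<exists>I\<in>set Is. (i, u) \<in> told I)})) \<rparr>"

end

locale lw_input = lw_protocol +
  fixes S :: "nat \<Rightarrow> tuple set" and D :: "nat \<Rightarrow> fact set"
  assumes k: "k \<ge> 3" and p: "p > 0" and m: "m > 0"
    and inst: "lw_instance k n m S" and part: "even_partition k p m S D"
    and H: "H = heavy_hitters k p m S"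
begin

section \<open>Basic properties of the input and its statistics\<close>

lemma S:
  assumes "i \<in> {1..k}"
  shows "S i \<subseteq> tuples (lw_vars k i) n" "card (S i) = m"
proof -
  have i: "is_relation n (lw_vars k i) (S i) \<and> card (S i) = m"
    using inst assms unfolding lw_instance_def by (rule bspec)
  then show "card (S i) = m" ..
  show "S i \<subseteq> tuples (lw_vars k i) n"
  proof
    fix t assume "t \<in> S i"
    then have "dom t = lw_vars k i \<and> ran t \<subseteq> {1..n}"
      using i unfolding is_relation_def by (metis (no_types))
    then show "t \<in> tuples (lw_vars k i) n" by (simp add: tuples_def)
  qed
qed

lemma finite_lw_vars [simp]: "finite (lw_vars k i)"
  by (simp add: lw_vars_def)

lemma card_lw_vars: "i \<in> {1..k} \<Longrightarrow> card (lw_vars k i) = k - 1"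
  by (simp add: lw_vars_def)

lemma finite_S: "i \<in> {1..k} \<Longrightarrow> finite (S i)"
  using S(1) finite_tuples finite_lw_vars finite_subset by blast

lemma finite_facts [simp]: "finite facts"
  by (simp add: facts_def)

definition "F = (SIGMA i:{1..k}. S i)"

lemma F_facts: "F \<subseteq> facts" unfolding F_def facts_def using S(1) by (intro Sigma_mono) auto

lemma finite_F [simp]: "finite F" using finite_S by (auto simp: F_def)

lemma card_F: "card F = k * m"
  unfolding F_def using finite_S S(2) by (subst card_SigmaI) auto

lemma D: "(\<Union>s<p. D s) = F" "s < p \<Longrightarrow> D s \<subseteq> F"
  "s < p \<Longrightarrow> s' < p \<Longrightarrow> s \<noteq> s' \<Longrightarrow> D s \<inter> D s' = {}"
  using part by (auto simp: even_partition_def F_def)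

lemma card_D: "s < p \<Longrightarrow> int (card (D s)) \<le> int k * \<lceil>real m / real p\<rceil>"
  using part by (simp add: even_partition_def)

lemma q_pos: "q > 0" and q_pow: "q ^ k \<le> p"
proof -
  have "root k 1 \<le> root k p" using p k by (intro real_root_le_mono) auto
  then show "q > 0" unfolding q_def using k by (simp add: le_nat_floor Suc_le_eq[symmetric])
  have "real q ^ k \<le> root k p ^ k" unfolding q_def using p by (intro power_mono of_nat_floor real_root_ge_zero) auto
  also have "\<dots> = p" using k by simp
  finally show "q ^ k \<le> p" by (metis of_nat_le_iff of_nat_power)
qed

text \<open>Over a domain of at most one value a relation has at most one tuple. Excluding this lets
  \<open>log 2 n\<close> absorb the rounding in \<open>width\<close>.\<close>

lemma n_ge_2: assumes "p \<ge> 2" "m \<ge> p" shows "n \<ge> 2"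
proof (rule ccontr)
  assume "\<not> n \<ge> 2"
  then have n: "n \<le> 1" by simp
  have "m = card (S 1)" using S(2)[of 1] k by simp
  also have "\<dots> \<le> card (tuples (lw_vars k 1) n)" using S(1)[of 1] k by (intro card_mono) auto
  also have "\<dots> \<le> n ^ card (lw_vars k 1)" by (intro card_tuples_le) simp
  also have "\<dots> \<le> 1" using n power_le_one by blast
  finally show False using assms by simp
qed

lemma listed_iff: "listed i h \<longleftrightarrow> i \<in> {1..k} \<and> m \<le> frequency (S i) h * p"
proof -
  have "real m / real p \<le> real x \<longleftrightarrow> m \<le> x * p" for x :: nat
    using p by (simp add: divide_le_eq flip: of_nat_mult)
  then show ?thesis unfolding listed_def unfolding H heavy_hitters_def by simp
qed

text \<open>No heavy partial tuple is missing from the statistics: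
  \<open>q ^ card (dom h) \<le> q ^ k \<le> p\<close> puts the heaviness threshold at or above the
  listing threshold \<open>m / p\<close>.\<close>

lemma heavy_iff:
  assumes "i \<in> {1..k}" "card (dom h) \<le> k"
  shows "heavy i h \<longleftrightarrow> m < frequency (S i) h * q ^ card (dom h)"
proof -
  have "q ^ card (dom h) \<le> p"
    using power_increasing[OF assms(2), of q] q_pos q_pow by simp
  then have "m \<le> frequency (S i) h * p" if "m < frequency (S i) h * q ^ card (dom h)"
    using that mult_le_mono2 by (meson less_imp_le order_trans)
  moreover have "heavy i h \<longleftrightarrow> listed i h \<and> m < frequency (S i) h * q ^ card (dom h)"
    unfolding heavy_def listed_def unfolding H heavy_hitters_def by auto
  ultimately show ?thesis using assms(1) by (auto simp: listed_iff)
qed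

lemma heavy_listed: "heavy i h \<Longrightarrow> listed i h"
  by (auto simp: heavy_def listed_def)

lemma listed_tuple:
  assumes "listed i h"
  shows "i \<in> {1..k}" "dom h \<subseteq> lw_vars k i" "ran h \<subseteq> {1..n}"
proof -
  show i: "i \<in> {1..k}" using assms listed_iff by auto
  have "frequency (S i) h \<noteq> 0"
    using assms m by (cases "frequency (S i) h") (auto simp: listed_iff)
  then have "{t \<in> S i. h \<subseteq>\<^sub>m t} \<noteq> {}" by (metis card.empty frequency_def)
  then obtain t where t: "t \<in> S i" "h \<subseteq>\<^sub>m t" by blast
  have "t \<in> tuples (lw_vars k i) n" using S(1) i t(1) by auto
  then have t': "dom t = lw_vars k i" "ran t \<subseteq> {1..n}" by (simp_all add: tuples_def)
  show "dom h \<subseteq> lw_vars k i" using map_le_implies_dom_le[OF t(2)] t'(1) by simp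
  have "ran h \<subseteq> ran t"
  proof
    fix b assume "b \<in> ran h"
    then obtain x where x: "h x = Some b" by (auto simp: ran_def)
    then have "t x = Some b" using t(2) by (metis domI map_le_def)
    then show "b \<in> ran t" by (rule ranI)
  qed
  then show "ran h \<subseteq> {1..n}" using t'(2) by (rule order_trans)
qed

lemma extension_listed:
  assumes "a \<in> extensions j t"
  obtains l h where "listed l h" "h j = Some a"
  using assms heavy_listed unfolding extensions_def
  by (fastforce simp: restrict_map_def)

lemma extension_le: "a \<in> extensions j t \<Longrightarrow> a \<in> {1..n}"
  using extension_listed listed_tuple(3) by (metis ranI subsetD)

lemma target_facts:
  assumes "X \<subseteq> facts"
  shows "target ` questions X \<subseteq> facts"
proof -
  have "(i, t(j \<mapsto> a) |` lw_vars k i) \<in> facts"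
    if "(j, t) \<in> X" "a \<in> extensions j t" "i \<in> {1..k}" for i j t a
  proof -
    have j: "j \<in> {1..k}" "dom t = lw_vars k j" "ran t \<subseteq> {1..n}"
      using that assms by (auto simp: facts_def tuples_def)
    have "ran (t(j \<mapsto> a) |` lw_vars k i) \<subseteq> {1..n}"
      using j(3) extension_le[OF that(2)] by (auto simp: ran_def restrict_map_def)
    moreover have "dom (t(j \<mapsto> a) |` lw_vars k i) = lw_vars k i"
      using j by (auto simp: lw_vars_def)
    ultimately show ?thesis using that(3) by (simp add: facts_def tuples_def)
  qed
  then show ?thesis by (auto simp: questions_def target_def)
qed

section \<open>Correctness\<close>

lemma n_pos: "n > 0"
proof -
  have "S 1 \<noteq> {}" using S(2)[of 1] k m by auto
  then obtain t where "t \<in> tuples (lw_vars k 1) n" using S(1)[of 1] k by fastforce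
  then have t: "dom t = lw_vars k 1" "ran t \<subseteq> {1..n}" by (simp_all add: tuples_def)
  have "2 \<in> dom t" unfolding t(1) using k by (simp add: lw_vars_def)
  then obtain a where "t 2 = Some a" by auto
  then have "a \<in> {1..n}" using t(2) by (auto intro: ranI)
  then show ?thesis by auto
qed

lemma encode: "encodes (UNIV \<times> facts) width encode"
proof -
  define v where "v = nat \<lceil>log 2 (real n)\<rceil> + 1"
  have "log 2 (real n) \<le> real v" unfolding v_def by linarith
  then have "real n \<le> 2 powr real v" using n_pos by (simp add: log_le_iff)
  then have "real n \<le> real (2 ^ v)" by (simp add: powr_realpow)
  then have n: "n \<le> 2 ^ v" by linarith
  have v: "v \<ge> 1" by (simp add: v_def)
  have k2: "k \<le> 2 ^ k" by (simp add: less_imp_le)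
  have "card (UNIV \<times> facts :: (bool \<times> fact) set) = 2 * (\<Sum>i\<in>{1..k}. card (tuples (lw_vars k i) n))"
    unfolding facts_def by (subst card_cartesian_product, subst card_SigmaI) auto
  also have "\<dots> \<le> 2 * (\<Sum>i\<in>{1..k}. n ^ (k - 1))"
    using card_tuples_le[OF finite_lw_vars] card_lw_vars by (intro mult_left_mono sum_mono) (metis, simp)
  also have "\<dots> = 2 * (k * n ^ (k - 1))" by simp
  also have "\<dots> \<le> 2 * (2 ^ k * (2 ^ v) ^ (k - 1))"
    using n k2 by (intro mult_left_mono mult_mono power_mono) auto
  also have "\<dots> = 2 ^ (1 + k + v * (k - 1))" by (simp add: power_add power_mult)
  also have "\<dots> \<le> 2 ^ (2 * k * v)"
  proof (rule power_increasing)
    have "1 * (k + 1) \<le> v * (k + 1)" using v by (intro mult_right_mono) auto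
    then have "1 + k + v * (k - 1) \<le> v * (k + 1) + v * (k - 1)" by simp
    also have "\<dots> = v * (k + 1 + (k - 1))" by (simp only: distrib_left)
    also have "\<dots> = 2 * k * v" using k by simp
    finally show "1 + k + v * (k - 1) \<le> 2 * k * v" .
  qed simp
  finally have "card (UNIV \<times> facts :: (bool \<times> fact) set) \<le> 2 ^ width" by (simp add: v_def width_def)
  moreover have "width > 0" using k by (simp add: width_def)
  ultimately have "\<exists>e. encodes (UNIV \<times> facts :: (bool \<times> fact) set) width e"
    by (intro ex_encodes) auto
  then show ?thesis unfolding encode_def by (rule someI_ex)
qed

lemma decode_encode: "X \<subseteq> UNIV \<times> facts \<Longrightarrow> decode (encode X) = X"
  using encode unfolding decode_def encodes_def by (simp add: inv_into_f_f)

lemma length_encode: "X \<subseteq> UNIV \<times> facts \<Longrightarrow> length (encode X) \<le> width * card X"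
  using encode unfolding encodes_def by blast

text \<open>There are \<open>q ^ k \<le> p\<close> cells, so numbering them assigns a server to
  each.\<close>

lemma grid: "\<forall>f \<in> {1..k} \<rightarrow> {..<q}. \<exists>s<p. \<forall>l\<in>{1..k}. grid s l = f l"
proof -
  let ?M = "{1..k} \<rightarrow>\<^sub>E {..<q}"
  have M: "finite ?M" "card ?M \<le> p" using q_pow by (auto simp: finite_PiE card_PiE)
  obtain g where g: "bij_betw g {0..<card ?M} ?M" using ex_bij_betw_nat_finite[OF M(1)] by auto
  have "\<exists>s<p. \<forall>l\<in>{1..k}. g s l = f l" if f: "f \<in> {1..k} \<rightarrow> {..<q}" for f
  proof -
    have "restrict f {1..k} \<in> g ` {0..<card ?M}" using f g by (auto simp: bij_betw_def)
    then obtain s where "s < card ?M" "restrict f {1..k} = g s" by auto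
    then show ?thesis using M(2) by (intro exI[of _ s]) (metis order_less_le_trans restrict_apply')
  qed
  then have "\<exists>g :: nat \<Rightarrow> nat \<Rightarrow> nat. \<forall>f \<in> {1..k} \<rightarrow> {..<q}. \<exists>s<p. \<forall>l\<in>{1..k}. g s l = f l"
    by blast
  then show ?thesis unfolding grid_def by (rule someI_ex)
qed

lemma inj_key: "inj_on key facts"
proof -
  have "\<exists>f :: fact \<Rightarrow> nat. inj_on f facts"
    using finite_imp_inj_to_nat_seg[OF finite_facts] by blast
  then show ?thesis unfolding key_def by (rule someI_ex)
qed

text \<open>Correctness is claimed for every seed in the support, so hash values must always name an
  existing server or grid coordinate.\<close>

lemma seed_range:
  assumes "\<omega> \<in> set_pmf (rand prot)"
  shows "y \<in> facts \<Longrightarrow> \<omega> 0 (key y) < p"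
    and "l \<in> {1..k} \<Longrightarrow> a \<in> {1..n} \<Longrightarrow> \<omega> l a < q"
proof -
  have row: "\<omega> l \<in> set_pmf (if l = 0 then Pi_pmf (key ` facts) 0 (\<lambda>_. pmf_of_set {..<p})
      else Pi_pmf {1..n} 0 (\<lambda>_. pmf_of_set {..<q}))" if "l \<le> k" for l
    using assms that unfolding prot_def by (auto simp: set_Pi_pmf PiE_dflt_def)
  have fin: "set_pmf (pmf_of_set {..<r}) = {..<r}" if "r > 0" for r :: nat
    using that by (intro set_pmf_of_set) auto
  show "\<omega> 0 (key y) < p" if "y \<in> facts"
  proof -
    have "\<omega> 0 \<in> PiE_dflt (key ` facts) 0 (set_pmf \<circ> (\<lambda>_. pmf_of_set {..<p}))"
      using row[of 0] by (simp add: set_Pi_pmf)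
    then have "\<omega> 0 (key y) \<in> set_pmf (pmf_of_set {..<p})"
      using that by (simp add: PiE_dflt_def)
    then show ?thesis unfolding fin[OF p] by simp
  qed
  show "\<omega> l a < q" if "l \<in> {1..k}" "a \<in> {1..n}"
  proof -
    have "\<omega> l \<in> PiE_dflt {1..n} 0 (set_pmf \<circ> (\<lambda>_. pmf_of_set {..<q}))"
      using row[of l] that by (simp add: set_Pi_pmf)
    then have "\<omega> l a \<in> set_pmf (pmf_of_set {..<q})"
      using that by (simp add: PiE_dflt_def)
    then show ?thesis unfolding fin[OF q_pos] by simp
  qed
qed

section \<open>Execution of the two rounds\<close>

abbreviation "replies \<omega> s s' \<equiv> asked \<omega> (D s) s' \<inter> shipped \<omega> F s'"

definition known :: "seed \<Rightarrow> nat \<Rightarrow> fact set" where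
  "known \<omega> s = D s \<union> shipped \<omega> F s \<union> (\<Union>s'<p. replies \<omega> s s')"

lemma shipped_subset: "shipped \<omega> X s \<subseteq> X"
  by (auto simp: shipped_def)

lemma asked_facts: "X \<subseteq> facts \<Longrightarrow> asked \<omega> X s \<subseteq> facts"
  using target_facts by (auto simp: asked_def)

lemma D_facts: "s < p \<Longrightarrow> D s \<subseteq> facts"
  using D(2) F_facts by blast

abbreviation "message1 \<omega> s s' \<equiv> Pair True ` shipped \<omega> (D s') s \<union> Pair False ` asked \<omega> (D s') s"

lemma message1: "s' < p \<Longrightarrow> message1 \<omega> s s' \<subseteq> UNIV \<times> facts"
  using shipped_subset asked_facts D_facts by blast

lemma send_Nil: "send prot \<omega> s X [] s' = encode (Pair True ` shipped \<omega> X s' \<union> Pair False ` asked \<omega> X s')"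
  and send_Cons: "send prot \<omega> s X (I # Is) s' = encode (Pair True ` ({y. (False, y) \<in> decode (I s')} \<inter> told I))"
  by (simp_all add: prot_def)

lemma history_1:
  "history prot p \<omega> D 1 s = [\<lambda>s'. if s' < p then encode (message1 \<omega> s s') else []]"
  by (simp add: send_Nil cong: if_cong)

text \<open>Whether a fact is shipped depends on that fact alone, so the partition over the senders
  disappears from the union.\<close>

lemma told_1: "told (history prot p \<omega> D 1 s ! 0) = shipped \<omega> F s"
proof -
  have "told (history prot p \<omega> D 1 s ! 0) = (\<Union>s'<p. shipped \<omega> (D s') s)"
    unfolding history_1 told_def by (auto simp: decode_encode[OF message1])
  also have "\<dots> = shipped \<omega> F s" unfolding D(1)[symmetric] by (auto simp: shipped_def)
  finally show ?thesis .
qed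

lemma history_2:
  assumes "s < p"
  shows "history prot p \<omega> D 2 s = history prot p \<omega> D 1 s @
    [\<lambda>s'. if s' < p then encode (Pair True ` replies \<omega> s s') else []]"
proof -
  have "send prot \<omega> s' (D s') (history prot p \<omega> D 1 s') s = encode (Pair True ` replies \<omega> s s')" for s'
  proof -
    obtain I where I: "history prot p \<omega> D 1 s' = [I]" "told I = shipped \<omega> F s'"
      using told_1[of \<omega> s'] history_1 by auto
    have "I s = encode (message1 \<omega> s' s)" using I(1) assms unfolding history_1 by auto
    then have "{y. (False, y) \<in> decode (I s)} = asked \<omega> (D s) s'"
      using decode_encode[OF message1[OF assms]] by auto
    then show ?thesis by (simp only: I send_Cons)
  qed
  then have "history prot p \<omega> D (Suc 1) s = history prot p \<omega> D 1 s @
    [\<lambda>s'. if s' < p then encode (Pair True ` replies \<omega> s s') else []]"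
    unfolding history.simps(2)[of _ _ _ _ 1] by auto
  then show ?thesis by (simp add: numeral_2_eq_2)
qed

lemma replies_facts: "Pair True ` replies \<omega> s s' \<subseteq> UNIV \<times> facts"
  using shipped_subset F_facts by blast

lemma mpc_result:
  "mpc_result prot p 2 \<omega> D = (\<Union>s<p. lw_join k (\<lambda>i. {u. (i, u) \<in> known \<omega> s}))"
proof -
  have "answer prot \<omega> s (D s) (history prot p \<omega> D 2 s) = lw_join k (\<lambda>i. {u. (i, u) \<in> known \<omega> s})"
    if s: "s < p" for s
  proof -
    have "told (\<lambda>s'. if s' < p then encode (Pair True ` replies \<omega> s s') else []) = (\<Union>s'<p. replies \<omega> s s')"
      unfolding told_def using decode_encode[OF replies_facts] by auto
    moreover have "set (history prot p \<omega> D 2 s) = {history prot p \<omega> D 1 s ! 0,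
        \<lambda>s'. if s' < p then encode (Pair True ` replies \<omega> s s') else []}"
      unfolding history_2[OF s] unfolding history_1 by auto
    ultimately have "(\<exists>I\<in>set (history prot p \<omega> D 2 s). y \<in> told I)
        \<longleftrightarrow> y \<in> shipped \<omega> F s \<or> y \<in> (\<Union>s'<p. replies \<omega> s s')" for y
      using told_1 by simp
    then show ?thesis by (simp add: prot_def known_def disj_assoc)
  qed
  then show ?thesis unfolding mpc_result_def by (intro SUP_cong) auto
qed

section \<open>Soundness and completeness of the output\<close>

lemma sound: assumes "s < p" shows "lw_join k (\<lambda>i. {u. (i, u) \<in> known \<omega> s}) \<subseteq> lw_join k S"
proof (rule lw_join_mono)
  have "known \<omega> s \<subseteq> F" unfolding known_def using D(2)[OF assms] shipped_subset by blast
  then show "{u. (i, u) \<in> known \<omega> s} \<subseteq> S i" for i by (auto simp: F_def)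
qed

text \<open>Grow a variable set one variable at a time from the empty set, which is not heavy. If a
  heavy set is ever reached, the variable \<open>j\<close> whose insertion first caused it makes
  \<open>x j\<close> an extension.\<close>

lemma lw_join_cases:
  assumes x: "x \<in> lw_join k S"
  shows "(\<forall>i\<in>{1..k}. light (i, x |` lw_vars k i)) \<or>
    (\<exists>j\<in>{1..k}. \<exists>a. x j = Some a \<and> a \<in> extensions j (x |` lw_vars k j))"
proof (rule disjCI)
  assume no_ext: "\<not> (\<exists>j\<in>{1..k}. \<exists>a. x j = Some a \<and> a \<in> extensions j (x |` lw_vars k j))"
  have dom: "dom x \<supseteq> lw_vars k i" if "i \<in> {1..k}" for i
    using x that by (auto simp: lw_join_def natural_join_def)
  show "\<forall>i\<in>{1..k}. light (i, x |` lw_vars k i)"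
  proof
    fix i assume i: "i \<in> {1..k}"
    have "\<not> heavy i (x |` U)" if "U \<subseteq> lw_vars k i" for U
      using finite_subset[OF that finite_lw_vars] that
    proof (induction rule: finite_induct)
      case empty
      have "heavy i Map.empty \<longleftrightarrow> m < frequency (S i) Map.empty"
        using i by (subst heavy_iff) auto
      then show ?case using S(2)[OF i] by (simp add: frequency_def)
    next
      case (insert j U)
      have j: "j \<in> {1..k}" using insert.prems by (auto simp: lw_vars_def)
      obtain a where a: "x j = Some a" using dom[OF i] insert.prems by blast
      have e1: "x |` lw_vars k j |` (insert j U - {j}) = x |` U"
        using insert by (auto simp: restrict_map_def lw_vars_def fun_eq_iff)
      have e2: "(x |` lw_vars k j)(j \<mapsto> a) |` insert j U = x |` insert j U"
        using insert a by (auto simp: restrict_map_def lw_vars_def fun_eq_iff)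
      have "a \<in> extensions j (x |` lw_vars k j)" if "heavy i (x |` insert j U)"
        unfolding extensions_def mem_Collect_eq
        by (intro bexI[of _ i] exI[of _ "insert j U"] conjI, unfold e1 e2, insert insert that i) auto
      then show ?case using no_ext a j by blast
    qed
    then show "light (i, x |` lw_vars k i)"
      by (auto simp: light_def Int_absorb1)
  qed
qed

lemma complete:
  assumes x: "x \<in> lw_join k S" and seed: "\<omega> \<in> set_pmf (rand prot)"
  shows "\<exists>s<p. x \<in> lw_join k (\<lambda>i. {u. (i, u) \<in> known \<omega> s})"
proof -
  have dom: "dom x = (\<Union>i\<in>{1..k}. lw_vars k i)" and xS: "\<And>i. i \<in> {1..k} \<Longrightarrow> x |` lw_vars k i \<in> S i"
    using x by (auto simp: lw_join_def natural_join_def)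
  have xF: "(i, x |` lw_vars k i) \<in> F" if "i \<in> {1..k}" for i using that xS by (simp add: F_def)
  have suff: "x \<in> lw_join k (\<lambda>i. {u. (i, u) \<in> known \<omega> s})"
    if "\<And>i. i \<in> {1..k} \<Longrightarrow> (i, x |` lw_vars k i) \<in> known \<omega> s" for s
    using that dom by (simp add: lw_join_def natural_join_def)
  from lw_join_cases[OF x] show ?thesis
  proof
    assume light: "\<forall>i\<in>{1..k}. light (i, x |` lw_vars k i)"
    have val: "the (x l) \<in> {1..n}" if l: "l \<in> {1..k}" for l
    proof -
      \<comment> \<open>Any relation index other than \<open>l\<close> works, since its tuples
        contain \<open>l\<close>.\<close>
      define i where "i = (if l = 1 then 2 else 1 :: nat)"
      have i: "i \<in> {1..k}" "l \<in> lw_vars k i" using l k by (auto simp: i_def lw_vars_def)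
      have "x |` lw_vars k i \<in> tuples (lw_vars k i) n" using xS S(1) i by blast
      then have "ran (x |` lw_vars k i) \<subseteq> {1..n}" by (simp add: tuples_def)
      moreover obtain a where "x l = Some a" using dom i by blast
      ultimately show ?thesis using i by (metis option.sel ranI restrict_in subsetD)
    qed
    have "(\<lambda>l. \<omega> l (the (x l))) \<in> {1..k} \<rightarrow> {..<q}"
      using seed_range(2)[OF seed _ val] by auto
    then obtain s where s: "s < p" "\<forall>l\<in>{1..k}. grid s l = \<omega> l (the (x l))"
      using bspec[OF grid] by blast
    have "(i, x |` lw_vars k i) \<in> known \<omega> s" if "i \<in> {1..k}" for i
      using that s light xF by (auto simp: known_def shipped_def lw_vars_def)
    then show ?thesis using s(1) suff by blast
  next
    assume "\<exists>j\<in>{1..k}. \<exists>a. x j = Some a \<and> a \<in> extensions j (x |` lw_vars k j)"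
    then obtain j a where j: "j \<in> {1..k}" "x j = Some a" "a \<in> extensions j (x |` lw_vars k j)"
      by blast
    let ?t = "x |` lw_vars k j"
    obtain s where s: "s < p" "(j, ?t) \<in> D s" using xF[OF j(1)] D(1) by auto
    have "(i, x |` lw_vars k i) \<in> known \<omega> s" if i: "i \<in> {1..k}" for i
    proof (cases "i = j")
      case True
      then show ?thesis using s by (simp add: known_def)
    next
      case False
      let ?y = "(i, x |` lw_vars k i)"
      have same: "x |` lw_vars k i |` lw_vars k j = ?t |` lw_vars k i"
        by (simp add: Int_commute)
      show ?thesis
      \<comment> \<open>A listed restriction suppresses the question, but then the fact is
        broadcast. Otherwise the home server of the fact confirms it.\<close>
      proof (cases "listed j (?t |` lw_vars k i)")
        case True
        obtain l h where "listed l h" "h j = Some a" using extension_listed[OF j(3)] .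
        moreover have "(x |` lw_vars k i) j = Some a" using j False by (simp add: lw_vars_def)
        ultimately have "\<exists>l h. listed l h \<and> j \<in> dom h \<and> h j = (x |` lw_vars k i) j"
          by (metis domI)
        then have "public ?y"
          using j(1) False True same unfolding public_def by (intro bexI[of _ j]) auto
        then show ?thesis using xF[OF i] by (simp add: known_def shipped_def)
      next
        case nl: False
        have "((j, ?t), a, i) \<in> questions (D s)"
          using s(2) j i False nl by (simp add: questions_def)
        moreover have "?t(j \<mapsto> a) |` lw_vars k i = x |` lw_vars k i"
          using j dom by (auto simp: restrict_map_def lw_vars_def fun_eq_iff)
        then have "target ((j, ?t), a, i) = ?y" by (simp add: target_def)
        ultimately have "?y \<in> target ` questions (D s)" by (metis imageI)
        moreover have "\<omega> 0 (key ?y) < p" using seed_range(1)[OF seed] xF[OF i] F_facts by blast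
        ultimately show ?thesis using xF[OF i] by (auto simp: known_def asked_def shipped_def)
      qed
    qed
    then show ?thesis using s(1) suff by blast
  qed
qed

lemma correct: "\<omega> \<in> set_pmf (rand prot) \<Longrightarrow> mpc_result prot p 2 \<omega> D = lw_join k S"
  unfolding mpc_result using sound complete by blast

section \<open>Load\<close>

lemma card_listed:
  "finite {h. dom h = U \<and> listed i h}" "card {h. dom h = U \<and> listed i h} \<le> p"
proof -
  show "finite {h. dom h = U \<and> listed i h}"
  proof (cases "i \<in> {1..k}")
    case True
    then show ?thesis using card_frequent(1)[OF finite_S[OF True] m, of U p] by (simp add: listed_iff)
  qed (simp add: listed_iff del: atLeastAtMost_iff)
  show "card {h. dom h = U \<and> listed i h} \<le> p"
  proof (cases "i \<in> {1..k}")
    case True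
    then have "m * card {h. dom h = U \<and> listed i h} \<le> m * p"
      using card_frequent(2)[OF finite_S[OF True] m, of U p] S(2)[OF True] by (simp add: listed_iff)
    then show ?thesis using m by simp
  qed (simp add: listed_iff del: atLeastAtMost_iff)
qed

text \<open>The heavy tuples \<open>t(j \<mapsto> a) |\<close>
  U\<open>have disjoint sets of extensions inside those of\<close>g = t |\<open>(U - {j})\<close>.
  Each has frequency above \<open>m / q ^ (card (dom g) + 1)\<close>, while \<open>g\<close> has at
  most \<open>m / q ^ card (dom g)\<close>.\<close>

lemma card_heavy_extensions:
  assumes i: "i \<in> {1..k}" and U: "U \<subseteq> lw_vars k i" "j \<in> U" and nh: "\<not> heavy i (t |` (U - {j}))"
  shows "finite {a. heavy i (t(j \<mapsto> a) |` U)}" "card {a. heavy i (t(j \<mapsto> a) |` U)} \<le> q"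
proof -
  define g where "g = t |` (U - {j})"
  define h where "h a = t(j \<mapsto> a) |` U" for a
  define X where "X = {a. heavy i (h a)}"
  have X: "{a. heavy i (t(j \<mapsto> a) |` U)} = X" by (simp only: X_def h_def)
  have h: "h a = g(j \<mapsto> a)" "dom (h a) = insert j (dom g)" for a
    using U by (auto simp: g_def h_def restrict_map_def fun_eq_iff split: if_splits)
  have "dom g \<subseteq> U - {j}" by (auto simp: g_def)
  then have jg: "j \<notin> dom g" and fg: "finite (dom g)" and sg: "insert j (dom g) \<subseteq> {1..k}"
    using U finite_subset[OF U(1)] by (auto simp: lw_vars_def intro: finite_subset)
  have c: "card (insert j (dom g)) = card (dom g) + 1" using jg fg by simp
  have ck: "card (insert j (dom g)) \<le> k" using card_mono[OF _ sg] by simp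
  have "X \<subseteq> {1..n}"
  proof
    fix a assume "a \<in> X"
    then have "heavy i (h a)" unfolding X_def by (rule CollectD)
    then have "ran (h a) \<subseteq> {1..n}" using listed_tuple(3) heavy_listed by blast
    then show "a \<in> {1..n}" using h(1) by (metis fun_upd_same ranI subsetD)
  qed
  then have fin: "finite X" by (rule finite_subset) simp
  then show "finite {a. heavy i (t(j \<mapsto> a) |` U)}" by (simp only: X)
  let ?R = "{u \<in> S i. g \<subseteq>\<^sub>m u}"
  have fR: "finite ?R" using finite_S[OF i] by simp
  have sub: "g \<subseteq>\<^sub>m h a" for a using jg by (auto simp: h(1) map_le_def)
  have fr: "frequency ?R (h a) = frequency (S i) (h a)" for a
    unfolding frequency_def using sub by (intro arg_cong[where f = card]) (auto intro: map_le_trans)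
  have inj: "inj_on h X"
    by (rule inj_onI) (metis h(1) fun_upd_same option.inject)
  have "(\<Sum>a\<in>X. frequency (S i) (h a)) = (\<Sum>v\<in>h ` X. frequency ?R v)"
    by (simp only: sum.reindex[OF inj] o_def fr)
  also have "\<dots> \<le> card ?R"
    by (rule frequency_sum_le[OF fR, where U = "insert j (dom g)"]) (use h(2) fin in blast)+
  also have "\<dots> = frequency (S i) g" by (simp add: frequency_def)
  finally have sum: "(\<Sum>a\<in>X. frequency (S i) (h a)) \<le> frequency (S i) g" .
  have g: "frequency (S i) g * q ^ card (dom g) \<le> m"
    using nh heavy_iff[OF i, of g] ck c by (simp add: g_def[symmetric])
  have "card X * (m + 1) \<le> (\<Sum>a\<in>X. frequency (S i) (h a) * q ^ (card (dom g) + 1))"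
  proof -
    have "m + 1 \<le> frequency (S i) (h a) * q ^ (card (dom g) + 1)" if "a \<in> X" for a
    proof -
      have "heavy i (h a)" using that unfolding X_def by (rule CollectD)
      then show ?thesis using heavy_iff[OF i, of "h a"] ck c unfolding h(2) by simp
    qed
    then have "(\<Sum>a\<in>X. m + 1) \<le> (\<Sum>a\<in>X. frequency (S i) (h a) * q ^ (card (dom g) + 1))"
      by (rule sum_mono)
    then show ?thesis by simp
  qed
  also have "\<dots> = (\<Sum>a\<in>X. frequency (S i) (h a)) * q ^ card (dom g) * q"
    by (simp add: sum_distrib_right mult.assoc mult.commute[of q])
  also have "\<dots> \<le> frequency (S i) g * q ^ card (dom g) * q"
    using sum by (intro mult_right_mono) auto
  also have "\<dots> \<le> m * q" using g by (intro mult_right_mono) auto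
  also have "\<dots> \<le> q * (m + 1)" by simp
  finally have "card X \<le> q" by (simp only: mult_le_cancel2)
  then show "card {a. heavy i (t(j \<mapsto> a) |` U)} \<le> q" by (simp only: X)
qed

text \<open>The previous count, summed over the at most \<open>k * 2 ^ k\<close> choices of relation
  and variable set.\<close>

lemma card_extensions:
  "finite (extensions j t)" "card (extensions j t) \<le> k * 2 ^ k * q"
proof -
  let ?X = "\<lambda>i U. {a. heavy i (t(j \<mapsto> a) |` U)}"
  let ?I = "SIGMA i:{1..k}. {U. U \<subseteq> lw_vars k i \<and> j \<in> U \<and> \<not> heavy i (t |` (U - {j}))}"
  have I: "?I \<subseteq> {1..k} \<times> Pow {1..k}" by (auto simp: lw_vars_def)
  then have fI: "finite ?I" by (rule finite_subset) simp
  have "card ?I \<le> card ({1..k} \<times> Pow {1..k})" using I by (intro card_mono) auto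
  then have cI: "card ?I \<le> k * 2 ^ k" by (simp add: card_cartesian_product card_Pow)
  have X: "finite (?X (fst x) (snd x)) \<and> card (?X (fst x) (snd x)) \<le> q" if "x \<in> ?I" for x
  proof -
    obtain i U where iU: "x = (i, U)" by (cases x)
    show ?thesis using that unfolding iU
      by (auto intro: card_heavy_extensions simp del: One_nat_def restrict_fun_upd)
  qed
  have eq: "extensions j t \<subseteq> (\<Union>x\<in>?I. ?X (fst x) (snd x))"
  proof
    fix a assume "a \<in> extensions j t"
    then obtain i U where "(i, U) \<in> ?I" "a \<in> ?X i U" unfolding extensions_def by blast
    then show "a \<in> (\<Union>x\<in>?I. ?X (fst x) (snd x))" by (intro UN_I[of "(i, U)"]) simp_all
  qed
  show "finite (extensions j t)" by (rule finite_subset[OF eq]) (use fI X in blast)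
  have "card (extensions j t) \<le> card (\<Union>x\<in>?I. ?X (fst x) (snd x))"
    by (rule card_mono[OF _ eq]) (use fI X in blast)
  also have "\<dots> \<le> (\<Sum>x\<in>?I. card (?X (fst x) (snd x)))" by (rule card_UN_le[OF fI])
  also have "\<dots> \<le> (\<Sum>x\<in>?I. q)" using X by (intro sum_mono) blast
  also have "\<dots> \<le> k * 2 ^ k * q" using cI by simp
  finally show "card (extensions j t) \<le> k * 2 ^ k * q" .
qed

abbreviation "fanout \<equiv> k ^ 2 * 2 ^ k * q"

lemma card_questions:
  assumes "finite X"
  shows "finite (questions X)" "card (questions X) \<le> card X * fanout"
proof -
  let ?Y = "SIGMA y:X. extensions (fst y) (snd y) \<times> {1..k}"
  have sub: "questions X \<subseteq> ?Y" by (auto simp: questions_def)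
  have fin: "finite ?Y" using assms card_extensions(1) by auto
  show "finite (questions X)" using sub fin by (rule finite_subset)
  have "card (questions X) \<le> card ?Y" using fin sub by (rule card_mono)
  also have "\<dots> = (\<Sum>y\<in>X. card (extensions (fst y) (snd y)) * k)"
    using assms card_extensions(1) by (subst card_SigmaI) (auto simp: card_cartesian_product)
  also have "\<dots> \<le> (\<Sum>y\<in>X. k * 2 ^ k * q * k)"
    using card_extensions(2) by (intro sum_mono mult_right_mono) auto
  also have "\<dots> = card X * fanout" by (simp add: power2_eq_square ac_simps)
  finally show "card (questions X) \<le> card X * fanout" .
qed

text \<open>A public tuple of \<open>S i\<close> is rebuilt from \<open>j\<close>, its listed
  restriction to \<open>lw_vars k j\<close> (at most \<open>p\<close> options) and its value at
  \<open>j\<close>, which occurs in some listed tuple (at most \<open>k * 2 ^ k * p\<close>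
  options).\<close>

lemma card_public: "card {y \<in> F. public y} \<le> k ^ 3 * 2 ^ k * p ^ 2"
proof -
  let ?G = "\<lambda>i U. {h. dom h = U \<and> listed i h}"
  define A where "A j = {a. \<exists>l h. listed l h \<and> h j = Some a}" for j
  have A: "finite (A j) \<and> card (A j) \<le> k * 2 ^ k * p" for j
  proof -
    let ?I = "{1..k} \<times> Pow {1..k}"
    let ?B = "\<Union>x\<in>?I. (\<lambda>h. the (h j)) ` ?G (fst x) (snd x)"
    have sub: "A j \<subseteq> ?B"
    proof
      fix a assume "a \<in> A j"
      then obtain l h where lh: "listed l h" "h j = Some a" by (auto simp: A_def)
      then have "(l, dom h) \<in> ?I" using listed_tuple(1,2)[OF lh(1)] by (auto simp: lw_vars_def)
      moreover have "a \<in> (\<lambda>h. the (h j)) ` ?G (fst (l, dom h)) (snd (l, dom h))"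
        using lh by (auto intro!: image_eqI[of _ _ h])
      ultimately show "a \<in> ?B" by blast
    qed
    have fin: "finite ?B" using card_listed(1) by auto
    have "card ?B \<le> (\<Sum>x\<in>?I. card ((\<lambda>h. the (h j)) ` ?G (fst x) (snd x)))" by (rule card_UN_le) simp
    also have "\<dots> \<le> (\<Sum>x\<in>?I. p)"
      using order_trans[OF card_image_le[OF card_listed(1)] card_listed(2)] by (intro sum_mono) blast
    also have "\<dots> = k * 2 ^ k * p" by (simp add: card_cartesian_product card_Pow)
    finally show ?thesis using finite_subset[OF sub fin] card_mono[OF fin sub] by linarith
  qed
  let ?Y = "\<lambda>(i, j). (\<lambda>(w, a). (i, w(j \<mapsto> a))) ` (?G j (lw_vars k i \<inter> lw_vars k j) \<times> A j)"
  let ?Z = "\<Union>x\<in>{1..k} \<times> {1..k}. ?Y x"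
  have Y: "finite (?Y x) \<and> card (?Y x) \<le> p * (k * 2 ^ k * p)" for x
  proof -
    obtain i j where x: "x = (i, j)" by (cases x)
    let ?P = "?G j (lw_vars k i \<inter> lw_vars k j) \<times> A j"
    have fin: "finite ?P" using A card_listed(1) by blast
    have "card (?Y x) \<le> card ?P" unfolding x prod.case by (rule card_image_le[OF fin])
    also have "\<dots> \<le> p * (k * 2 ^ k * p)"
      unfolding card_cartesian_product using A card_listed(2) by (intro mult_mono) auto
    finally show ?thesis using fin x by auto
  qed
  have sub: "{y \<in> F. public y} \<subseteq> ?Z"
  proof
    fix y assume "y \<in> {y \<in> F. public y}"
    then have y: "y \<in> F" "public y" by auto
    obtain i u where iu: "y = (i, u)" by (cases y)
    have i: "i \<in> {1..k}" "u \<in> S i" using y(1) iu by (auto simp: F_def)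
    then have "u \<in> tuples (lw_vars k i) n" using S(1) by blast
    then have u: "dom u = lw_vars k i" by (simp add: tuples_def)
    obtain j l h where j: "j \<in> {1..k}" "j \<noteq> i" "listed j (u |` lw_vars k j)" "listed l h" "j \<in> dom h" "h j = u j"
      using y(2) unfolding public_def iu fst_conv snd_conv by blast
    then obtain a where a: "h j = Some a" "u j = Some a" by (metis domD)
    have "u = (u |` lw_vars k j)(j \<mapsto> a)"
    proof
      fix z
      show "u z = ((u |` lw_vars k j)(j \<mapsto> a)) z"
      proof (cases "z \<in> {1..k}")
        case False
        then have "z \<notin> dom u" by (simp add: u lw_vars_def del: atLeastAtMost_iff)
        then have "u z = None" "z \<noteq> j" using False j(1) by (auto simp: domIff)
        then show ?thesis by (simp add: restrict_map_def)
      qed (use a in \<open>auto simp: restrict_map_def lw_vars_def\<close>)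
    qed
    moreover have "u |` lw_vars k j \<in> ?G j (lw_vars k i \<inter> lw_vars k j)" using j(3) u by simp
    moreover have "a \<in> A j" using j(4) a(1) by (auto simp: A_def)
    ultimately have "y \<in> ?Y (i, j)"
      unfolding iu prod.case by (intro image_eqI[of _ _ "(u |` lw_vars k j, a)"] SigmaI) (simp only: prod.case)
    then show "y \<in> ?Z" using i(1) j(1) by blast
  qed
  have "finite ?Z" using Y by blast
  then have "card {y \<in> F. public y} \<le> card ?Z" using sub by (rule card_mono)
  also have "\<dots> \<le> (\<Sum>x\<in>{1..k} \<times> {1..k}. card (?Y x))" by (rule card_UN_le) simp
  also have "\<dots> \<le> (\<Sum>x\<in>{1..k} \<times> {1..k}. p * (k * 2 ^ k * p))" using Y by (intro sum_mono) blast
  also have "\<dots> = k ^ 3 * 2 ^ k * p ^ 2"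
    by (simp add: card_cartesian_product power2_eq_square power3_eq_cube ac_simps)
  finally show ?thesis .
qed

section \<open>Weight of a fact at its home server\<close>

text \<open>Cost that \<open>y\<close> brings to its home server in round one: storing it, plus all
  questions about it counted with multiplicity, as different servers may ask the same.\<close>

definition weight :: "fact \<Rightarrow> nat" where
  "weight y = of_bool (y \<in> F) + card {Q \<in> questions F. target Q = y}"

lemma weight_le: "real (weight y) \<le> 1 + real k * (real m / real p)"
proof -
  obtain i u where y: "y = (i, u)" by (cases y)
  let ?J = "{j \<in> {1..k}. \<not> listed j (u |` lw_vars k j)}"
  let ?T = "\<lambda>j. {t \<in> S j. u |` lw_vars k j \<subseteq>\<^sub>m t}"
  let ?Q = "{Q \<in> questions F. target Q = y}"
  have Q: "fst Q \<in> Sigma ?J ?T \<and> Q = (fst Q, the (u (fst (fst Q))), i)" if Q: "Q \<in> ?Q" for Q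
  proof -
    obtain j t a where jt: "Q = ((j, t), a, i)" "(j, t) \<in> F" "i \<in> {1..k} - {j}"
        "\<not> listed j (t |` lw_vars k i)" "u = t(j \<mapsto> a) |` lw_vars k i"
      using Q unfolding y questions_def target_def by (auto simp del: restrict_fun_upd)
    have j: "j \<in> {1..k}" "t \<in> S j" using jt(2) by (auto simp: F_def)
    then have "t \<in> tuples (lw_vars k j) n" using S(1) by blast
    then have "dom t = lw_vars k j" by (simp add: tuples_def)
    then have "u |` lw_vars k j = t |` lw_vars k i"
      unfolding jt(5) by (auto simp: restrict_map_def lw_vars_def fun_eq_iff domIff)
    moreover have "t |` lw_vars k i \<subseteq>\<^sub>m t" by (auto simp: map_le_def restrict_map_def dom_def)
    moreover have "u j = Some a" using jt(3,5) j(1) by (simp add: lw_vars_def)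
    ultimately show ?thesis using jt j by auto
  qed
  have fin: "finite (Sigma ?J ?T)" using finite_S by auto
  have "card ?Q \<le> card (Sigma ?J ?T)"
  proof (rule card_inj_on_le[OF _ _ fin])
    show "inj_on fst ?Q"
    proof (rule inj_onI)
      fix Q1 Q2 assume a: "Q1 \<in> ?Q" "Q2 \<in> ?Q" "fst Q1 = fst Q2"
      have "Q1 = (fst Q1, the (u (fst (fst Q1))), i)" using Q[OF a(1)] by (rule conjunct2)
      also have "\<dots> = (fst Q2, the (u (fst (fst Q2))), i)" by (simp only: a(3))
      also have "\<dots> = Q2" using Q[OF a(2)] by (rule sym[OF conjunct2])
      finally show "Q1 = Q2" .
    qed
    show "fst ` ?Q \<subseteq> Sigma ?J ?T" using Q by blast
  qed
  also have "\<dots> = (\<Sum>j\<in>?J. frequency (S j) (u |` lw_vars k j))"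
    unfolding frequency_def using finite_S by (subst card_SigmaI) auto
  finally have "real (card ?Q) \<le> (\<Sum>j\<in>?J. real (frequency (S j) (u |` lw_vars k j)))"
    by (simp flip: of_nat_sum)
  also have "\<dots> \<le> (\<Sum>j\<in>?J. real m / real p)"
  proof (rule sum_mono)
    fix j assume "j \<in> ?J"
    then have "frequency (S j) (u |` lw_vars k j) * p < m" by (auto simp: listed_iff)
    then have "real (frequency (S j) (u |` lw_vars k j)) * real p \<le> real m"
      by (simp flip: of_nat_mult)
    then show "real (frequency (S j) (u |` lw_vars k j)) \<le> real m / real p"
      using p by (simp add: field_simps)
  qed
  also have "\<dots> = real (card ?J) * (real m / real p)" by simp
  also have "\<dots> \<le> real k * (real m / real p)"
  proof -
    have "card ?J \<le> card {1..k}" by (rule card_mono) auto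
    then show ?thesis by (intro mult_right_mono) auto
  qed
  finally show ?thesis by (simp add: weight_def of_bool_def)
qed

lemma questions_F_target: "Q \<in> questions F \<Longrightarrow> target Q \<in> facts"
  using target_facts[OF F_facts] by blast

lemma sum_weight_filter:
  "(\<Sum>y | y \<in> facts \<and> P y. weight y) = card {y \<in> F. P y} + card {Q \<in> questions F. P (target Q)}"
proof -
  have "(\<Sum>y | y \<in> facts \<and> P y. weight y) = (\<Sum>y | y \<in> facts \<and> P y. of_bool (y \<in> F))
      + (\<Sum>y | y \<in> facts \<and> P y. card {Q \<in> questions F. target Q = y})"
    by (simp add: weight_def sum.distrib)
  also have "(\<Sum>y | y \<in> facts \<and> P y. of_bool (y \<in> F)) = card {y \<in> F. P y}"
    using F_facts by (auto simp: of_bool_def sum.If_cases intro!: arg_cong[where f = card])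
  also have "(\<Sum>y | y \<in> facts \<and> P y. card {Q \<in> questions F. target Q = y})
      = card (\<Union>y\<in>{y. y \<in> facts \<and> P y}. {Q \<in> questions F. target Q = y})"
    using card_questions(1)[OF finite_F] by (intro card_UN_disjoint[symmetric]) auto
  also have "(\<Union>y\<in>{y. y \<in> facts \<and> P y}. {Q \<in> questions F. target Q = y}) = {Q \<in> questions F. P (target Q)}"
    using questions_F_target by auto
  finally show ?thesis .
qed

lemma sum_weight: "(\<Sum>y\<in>facts. weight y) \<le> k * m * (1 + fanout)"
  using sum_weight_filter[of "\<lambda>_. True"] card_questions(2)[OF finite_F] by (simp add: card_F)

abbreviation "cell \<omega> i s \<equiv>
  {u \<in> {u \<in> S i. light (i, u)}. \<forall>z\<in>lw_vars k i. \<omega> z (the (u z)) = grid s z}"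

lemma card_shipped:
  "card (shipped \<omega> F s) \<le> (\<Sum>i\<in>{1..k}. card (cell \<omega> i s)) + card {y \<in> F. \<omega> 0 (key y) = s}
     + k ^ 3 * 2 ^ k * p ^ 2"
proof -
  have "shipped \<omega> F s \<subseteq> Sigma {1..k} (\<lambda>i. cell \<omega> i s) \<union> {y \<in> F. \<omega> 0 (key y) = s} \<union> {y \<in> F. public y}"
    by (auto simp: shipped_def F_def)
  then have "card (shipped \<omega> F s)
      \<le> card (Sigma {1..k} (\<lambda>i. cell \<omega> i s) \<union> {y \<in> F. \<omega> 0 (key y) = s} \<union> {y \<in> F. public y})"
    using finite_S by (intro card_mono) auto
  also have "\<dots> \<le> card (Sigma {1..k} (\<lambda>i. cell \<omega> i s)) + card {y \<in> F. \<omega> 0 (key y) = s} + card {y \<in> F. public y}"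
    by (intro order_trans[OF card_Un_le] add_right_mono card_Un_le)
  also have "card (Sigma {1..k} (\<lambda>i. cell \<omega> i s)) = (\<Sum>i\<in>{1..k}. card (cell \<omega> i s))"
    using finite_S by (subst card_SigmaI) auto
  finally show ?thesis using card_public by linarith
qed

text \<open>A question carries the fact it originates from. As the initial parts are disjoint,
  questions of different senders are distinct and can be counted globally.\<close>

lemma sum_card_asked_senders:
  "(\<Sum>s'<p. card (asked \<omega> (D s') s)) \<le> card {Q \<in> questions F. \<omega> 0 (key (target Q)) = s}"
proof -
  let ?A = "\<lambda>s'. {Q \<in> questions (D s'). \<omega> 0 (key (target Q)) = s}"
  have fin: "finite (questions (D s'))" if "s' < p" for s'
    using D(2)[OF that] card_questions(1) finite_F finite_subset by blast
  have "(\<Sum>s'<p. card (asked \<omega> (D s') s)) \<le> (\<Sum>s'<p. card (?A s'))"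
  proof (rule sum_mono)
    fix s' assume "s' \<in> {..<p}"
    moreover have "asked \<omega> (D s') s = target ` ?A s'" by (auto simp: asked_def)
    ultimately show "card (asked \<omega> (D s') s) \<le> card (?A s')" using fin by (auto intro: card_image_le)
  qed
  also have "\<dots> = card (\<Union>s'<p. ?A s')"
  proof (intro card_UN_disjoint[symmetric] ballI impI)
    fix s' s'' assume s: "s' \<in> {..<p}" "s'' \<in> {..<p}" "s' \<noteq> s''"
    have "fst Q \<in> X" if "Q \<in> questions X" for Q X using that by (auto simp: questions_def)
    then show "?A s' \<inter> ?A s'' = {}" using D(3)[of s' s''] s by blast
  qed (use fin in auto)
  also have "(\<Union>s'<p. ?A s') = {Q \<in> questions F. \<omega> 0 (key (target Q)) = s}"
    unfolding D(1)[symmetric] by (auto simp: questions_def)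
  finally show ?thesis .
qed

text \<open>The hash sends each target to one home only, so the sets asked of different servers are
  disjoint.\<close>

lemma sum_card_asked_receivers:
  assumes "s < p"
  shows "(\<Sum>s'<p. card (asked \<omega> (D s) s')) \<le> card (D s) * fanout"
proof -
  have finD: "finite (D s)" using D(2)[OF assms] finite_F finite_subset by blast
  then have fin: "finite (target ` questions (D s))" using card_questions(1) by blast
  have "(\<Sum>s'<p. card (asked \<omega> (D s) s')) = card (\<Union>s'<p. asked \<omega> (D s) s')"
    using fin by (intro card_UN_disjoint[symmetric]) (auto simp: asked_def)
  also have "\<dots> \<le> card (target ` questions (D s))"
    using fin by (intro card_mono) (auto simp: asked_def)
  also have "\<dots> \<le> card (questions (D s))" using card_questions(1)[OF finD] by (rule card_image_le)
  also have "\<dots> \<le> card (D s) * fanout" by (rule card_questions(2)[OF finD])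
  finally show ?thesis .
qed

section \<open>Bits received in each round\<close>

lemma bits_received_0:
  "bits_received prot p \<omega> D 0 s \<le> width * ((\<Sum>i\<in>{1..k}. card (cell \<omega> i s))
     + (\<Sum>y | y \<in> facts \<and> \<omega> 0 (key y) = s. weight y) + k ^ 3 * 2 ^ k * p ^ 2)"
proof -
  have finD: "finite (D s')" if "s' < p" for s' using D(2)[OF that] finite_F finite_subset by blast
  have "bits_received prot p \<omega> D 0 s = (\<Sum>s'<p. length (encode (message1 \<omega> s s')))"
    unfolding bits_received_def using history_1 by simp
  also have "\<dots> \<le> (\<Sum>s'<p. width * (card (shipped \<omega> (D s') s) + card (asked \<omega> (D s') s)))"
  proof (rule sum_mono)
    fix s' assume s': "s' \<in> {..<p}"
    have fin: "finite (shipped \<omega> (D s') s)" "finite (asked \<omega> (D s') s)"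
      using s' finD card_questions(1) by (auto simp: shipped_def asked_def)
    have "length (encode (message1 \<omega> s s')) \<le> width * card (message1 \<omega> s s')"
      using message1 s' by (intro length_encode) auto
    also have "\<dots> \<le> width * (card (shipped \<omega> (D s') s) + card (asked \<omega> (D s') s))"
      by (intro mult_left_mono order_trans[OF card_Un_le] add_mono card_image_le fin) simp
    finally show "length (encode (message1 \<omega> s s')) \<le> \<dots>" .
  qed
  also have "\<dots> = width * ((\<Sum>s'<p. card (shipped \<omega> (D s') s)) + (\<Sum>s'<p. card (asked \<omega> (D s') s)))"
    by (simp only: sum_distrib_left[symmetric] sum.distrib)
  also have "(\<Sum>s'<p. card (shipped \<omega> (D s') s)) = card (\<Union>s'<p. shipped \<omega> (D s') s)"
  proof (intro card_UN_disjoint[symmetric] ballI impI)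
    fix s' s'' assume "s' \<in> {..<p}" "s'' \<in> {..<p}" "s' \<noteq> s''"
    then show "shipped \<omega> (D s') s \<inter> shipped \<omega> (D s'') s = {}"
      using D(3)[of s' s''] shipped_subset by blast
  qed (use finD in \<open>auto simp: shipped_def\<close>)
  also have "(\<Union>s'<p. shipped \<omega> (D s') s) = shipped \<omega> F s"
    unfolding D(1)[symmetric] by (auto simp: shipped_def)
  also have "width * (card (shipped \<omega> F s) + (\<Sum>s'<p. card (asked \<omega> (D s') s)))
      \<le> width * ((\<Sum>i\<in>{1..k}. card (cell \<omega> i s))
     + (\<Sum>y | y \<in> facts \<and> \<omega> 0 (key y) = s. weight y) + k ^ 3 * 2 ^ k * p ^ 2)"
    using card_shipped[of \<omega> s] sum_card_asked_senders[of \<omega> s]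
    unfolding sum_weight_filter by (intro mult_left_mono) auto
  finally show ?thesis .
qed

text \<open>A server receives no more replies than it asked for, so round two is controlled by its
  own initial part, whatever the seed.\<close>

lemma bits_received_1:
  assumes s: "s < p"
  shows "bits_received prot p \<omega> D 1 s \<le> width * (card (D s) * fanout)"
proof -
  have "history prot p \<omega> D (Suc 1) s ! 1 = (\<lambda>s'. if s' < p then encode (Pair True ` replies \<omega> s s') else [])"
    using history_2[OF s] history_1 by (simp add: numeral_2_eq_2 nth_append)
  then have "bits_received prot p \<omega> D 1 s = (\<Sum>s'<p. length (encode (Pair True ` replies \<omega> s s')))"
    unfolding bits_received_def by simp
  also have "\<dots> \<le> (\<Sum>s'<p. width * card (asked \<omega> (D s) s'))"
  proof (rule sum_mono)
    fix s' assume "s' \<in> {..<p}"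
    have fin: "finite (asked \<omega> (D s) s')"
      using asked_facts[OF D_facts[OF s]] finite_facts by (rule finite_subset)
    have "length (encode (Pair True ` replies \<omega> s s')) \<le> width * card (Pair True ` replies \<omega> s s')"
      using replies_facts by (rule length_encode)
    also have "\<dots> \<le> width * card (asked \<omega> (D s) s')"
      using fin by (intro mult_left_mono order_trans[OF card_image_le] card_mono) auto
    finally show "length (encode (Pair True ` replies \<omega> s s')) \<le> width * card (asked \<omega> (D s) s')" .
  qed
  also have "\<dots> = width * (\<Sum>s'<p. card (asked \<omega> (D s) s'))" by (simp only: sum_distrib_left)
  also have "\<dots> \<le> width * (card (D s) * fanout)"
    using sum_card_asked_receivers[OF s] by (intro mult_left_mono) auto
  finally show ?thesis .
qed

section \<open>Failure probabilities\<close>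

lemma prob_cell:
  fixes K :: real
  assumes i: "i \<in> {1..k}" and K: "K \<ge> 1"
  shows "measure_pmf.prob (rand prot) {\<omega>. \<exists>s<p. K ^ (k - 1) * m / q ^ (k - 1) < card (cell \<omega> i s)}
    \<le> k * (2 ^ k * p * p * exp (2 - K))"
proof -
  let ?V = "lw_vars k i"
  let ?L = "{u \<in> S i. light (i, u)}"
  have V: "card ?V = k - 1" by (rule card_lw_vars[OF i])
  have finL: "finite ?L" using finite_S[OF i] by simp
  have L: "dom t = ?V \<and> ran t \<subseteq> {1..n}" if "t \<in> ?L" for t
  proof -
    have "t \<in> tuples ?V n" using that S(1)[OF i] by blast
    then show ?thesis by (simp add: tuples_def)
  qed
  \<comment> \<open>A partial tuple that occurs among the light tuples is a restriction of one of
    them, hence not heavy.\<close>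
  have few: "frequency ?L h * q ^ card (dom h) \<le> m" if h: "dom h \<subseteq> ?V" for h
  proof (cases "frequency ?L h = 0")
    case False
    then have "{u \<in> ?L. h \<subseteq>\<^sub>m u} \<noteq> {}"
      by (rule contrapos_nn) (simp only: frequency_def card.empty)
    then obtain u where u: "u \<in> ?L" "h \<subseteq>\<^sub>m u" by blast
    have "u |` dom h = h" using iffD1[OF map_le_iff_restrict u(2)] by (rule sym)
    moreover have "\<not> heavy i (u |` dom h)" using u(1) h by (simp add: light_def)
    ultimately have nh: "\<not> heavy i h" by simp
    have "card (dom h) \<le> k" using card_mono[OF finite_lw_vars h] V by simp
    then have "frequency (S i) h * q ^ card (dom h) \<le> m" using nh heavy_iff[OF i] by simp
    moreover have "frequency ?L h \<le> frequency (S i) h"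
      using finite_S[OF i] by (intro frequency_mono) auto
    ultimately show ?thesis by (meson mult_le_mono1 order_trans)
  qed simp
  have "q ^ card ?V \<le> q ^ k" unfolding V using q_pos by (intro power_increasing) auto
  then have qV: "q ^ card ?V \<le> p" using q_pow by simp
  have "measure_pmf.prob (rand prot) {\<omega>. \<exists>s<p. K ^ card ?V * m / q ^ card ?V < card (cell \<omega> i s)}
    \<le> card ?V * (2 ^ card ?V * p * p * exp (2 - K))"
    unfolding prot_def protocol.simps
    by (rule hypercube_load[OF finite_lw_vars finL L m q_pos p qV K few])
       (auto simp: lw_vars_def)
  also have "\<dots> \<le> k * (2 ^ k * p * p * exp (2 - K))"
    unfolding V by (intro mult_mono of_nat_mono mult_right_mono) (auto intro: power_increasing)
  finally show ?thesis unfolding V .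
qed

text \<open>Only row \<open>0\<close> matters here: the bucket bound is applied to weights
  transported along \<open>key\<close>, with a union bound over the \<open>p\<close>
  servers.\<close>

lemma prob_weight:
  fixes B :: real
  assumes B: "B > 0" "\<And>y. real (weight y) \<le> B" "real (\<Sum>y\<in>facts. weight y) \<le> p * B"
  shows "measure_pmf.prob (rand prot)
      {\<omega>. \<exists>s<p. K * B < real (\<Sum>y | y \<in> facts \<and> \<omega> 0 (key y) = s. weight y)} \<le> p * exp (2 - K)"
proof -
  define w where "w a = real (weight (inv_into facts key a))" for a
  have w_key: "w (key y) = real (weight y)" if "y \<in> facts" for y
    using that inj_key by (simp add: w_def)
  have sum_w: "(\<Sum>a | a \<in> key ` facts \<and> f a = s. w a) = real (\<Sum>y | y \<in> facts \<and> f (key y) = s. weight y)"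
    for f :: "nat \<Rightarrow> nat" and s
  proof -
    have "{a. a \<in> key ` facts \<and> f a = s} = key ` {y. y \<in> facts \<and> f (key y) = s}" by auto
    moreover have "inj_on key {y. y \<in> facts \<and> f (key y) = s}" using inj_key by (auto simp: inj_on_def)
    ultimately show ?thesis by (simp add: sum.reindex w_key)
  qed
  have "measure_pmf.prob (Pi_pmf (key ` facts) 0 (\<lambda>_. pmf_of_set {..<p}))
      {r. \<exists>s\<in>{..<p}. K * B < (\<Sum>a | a \<in> key ` facts \<and> r a = s. w a)} \<le> (\<Sum>s\<in>{..<p}. exp (2 - K))"
  proof (intro prob_pmf_union_bound prob_hash_bucket)
    have "sum w (key ` facts) = real (\<Sum>y\<in>facts. weight y)"
      using inj_key by (simp add: sum.reindex w_key)
    then show "sum w (key ` facts) \<le> real p * B" using B(3) by simp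
  qed (use B p in \<open>auto simp: w_def\<close>)
  then have row: "measure_pmf.prob (Pi_pmf (key ` facts) 0 (\<lambda>_. pmf_of_set {..<p}))
      {r. \<exists>s<p. K * B < real (\<Sum>y | y \<in> facts \<and> r (key y) = s. weight y)} \<le> p * exp (2 - K)"
    by (simp add: sum_w Bex_def)
  show ?thesis unfolding prot_def protocol.simps
    by (rule prob_Pi_pmf_resample[where z = 0]) (use row in auto)
qed

section \<open>Comparison with the claimed load\<close>

definition side :: real where
  "side = real p powr (1 / k)"

text \<open>\<open>q\<close> is the integer part of \<open>side\<close>. As
  \<open>q \<ge> 1\<close>, rounding costs at most a factor 2 per dimension of the grid.\<close>

lemma side: "side \<ge> 1" "side ^ k = p" "p powr (1 - 1 / k) = side ^ (k - 1)"
  "real q \<le> side" "side \<le> 2 * real q"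
proof -
  show 1: "side \<ge> 1" unfolding side_def using p by (intro ge_one_powr_ge_zero) auto
  have pw: "side ^ j = p powr (j / k)" for j
    using 1 p by (simp add: side_def powr_realpow[symmetric] powr_powr)
  show "side ^ k = p" unfolding pw using k p by simp
  have "1 - 1 / real k = real (k - 1) / real k" using k by (simp add: field_simps)
  then show "p powr (1 - 1 / k) = side ^ (k - 1)" by (simp only: pw)
  have root: "root k (real p) = side" unfolding side_def using k by (simp add: root_powr_inverse)
  show "real q \<le> side" unfolding q_def root using 1 by (intro of_nat_floor) simp
  have "side < real q + 1" unfolding q_def root using 1 by linarith
  then show "side \<le> 2 * real q" using q_pos by linarith
qed

definition target_load :: real where
  "target_load = real m / real p powr (1 - 1 / real k)"

lemma target_load: "target_load = m / side ^ (k - 1)" "target_load * p = m * side"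
  "real m / real p \<le> target_load"
proof -
  show 1: "target_load = m / side ^ (k - 1)" by (simp add: target_load_def side)
  have pw: "side ^ (k - 1) * side = p" using k side(2) by (metis power_minus_mult neq0_conv not_numeral_le_zero)
  then show 2: "target_load * p = m * side" using side(1) unfolding 1 by (simp flip: pw)
  have "real m * 1 \<le> real m * side" using side(1) by (intro mult_left_mono) auto
  then show "real m / real p \<le> target_load" using p 2 by (simp add: divide_le_eq)
qed

lemma mpc_load_le:
  assumes "\<And>s. s < p \<Longrightarrow> real (bits_received prot p \<omega> D 0 s) \<le> X"
    and "\<And>s. s < p \<Longrightarrow> real (bits_received prot p \<omega> D 1 s) \<le> X"
  shows "real (mpc_load prot p 2 \<omega> D) \<le> X"
proof -
  let ?A = "{bits_received prot p \<omega> D r s | r s. r < 2 \<and> s < p}"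
  have eq: "?A = (\<lambda>(r, s). bits_received prot p \<omega> D r s) ` ({..<2} \<times> {..<p})" by auto
  have "finite ?A" unfolding eq by simp
  moreover have "?A \<noteq> {}" unfolding eq using p by (simp add: lessThan_empty_iff)
  ultimately have "Max ?A \<in> ?A" by (rule Max_in)
  then obtain r s where "Max ?A = bits_received prot p \<omega> D r s" "r < 2" "s < p" by auto
  then show ?thesis using assms unfolding mpc_load_def by (auto simp: less_2_cases_iff)
qed

definition branching :: real where
  "branching = k ^ 2 * 2 ^ k"

lemma fanout_le: "real fanout \<le> branching * side"
  using side(4) by (auto simp: branching_def intro!: mult_left_mono)

text \<open>The scale \<open>B\<close> for the bucket bound: it dominates both a single weight and
  the average weight per server.\<close>

definition capacity :: real where
  "capacity = k * (1 + branching) * target_load"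

lemma branching: "branching \<ge> 1"
proof -
  have "(1 :: real) * 1 \<le> real k ^ 2 * 2 ^ k" using k by (intro mult_mono one_le_power) auto
  then show ?thesis by (simp add: branching_def)
qed

lemma target_load_pos: "target_load > 0"
  using m side(1) by (simp add: target_load(1))

lemma capacity:
  assumes "m \<ge> p"
  shows "capacity > 0" "real (weight y) \<le> capacity" "real (\<Sum>y\<in>facts. weight y) \<le> p * capacity"
proof -
  show "capacity > 0" using k branching target_load_pos by (simp add: capacity_def)
  have "1 \<le> real m / real p" using assms p by simp
  then have "real (weight y) \<le> real m / real p + real k * (real m / real p)"
    using weight_le[of y] by linarith
  also have "\<dots> = (1 + real k) * (real m / real p)" by (simp only: distrib_right mult_1)
  also have "\<dots> \<le> (1 + real k) * target_load" using target_load(3) by (intro mult_left_mono) auto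
  also have "\<dots> \<le> (k * (1 + branching)) * target_load"
  proof (intro mult_right_mono)
    have "real k * 1 \<le> real k * branching" using branching by (intro mult_left_mono) auto
    then show "1 + real k \<le> k * (1 + branching)" unfolding distrib_left using k by linarith
  qed (use target_load_pos in simp)
  finally show "real (weight y) \<le> capacity" by (simp add: capacity_def)
  have "real (\<Sum>y\<in>facts. weight y) \<le> real (k * m * (1 + fanout))"
    using sum_weight by (rule of_nat_mono)
  also have "\<dots> = k * m * (1 + real fanout)" by (simp add: distrib_left)
  also have "\<dots> \<le> k * m * (side + branching * side)"
    using fanout_le side(1) by (intro mult_left_mono add_mono) auto
  also have "\<dots> = k * (1 + branching) * (m * side)" by (simp add: algebra_simps)
  also have "\<dots> = p * capacity" unfolding target_load(2)[symmetric] capacity_def by simp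
  finally show "real (\<Sum>y\<in>facts. weight y) \<le> p * capacity" .
qed

text \<open>The first two summands pay for grid cells and home servers. The last covers the
  broadcast in round one and, separately, all replies of round two.\<close>

definition const :: real where
  "const = k * 2 ^ k + k * (1 + branching) + 2 * k * branching"

text \<open>The deterministic part: what remains once all buckets behave. Here
  \<open>m \<ge> p ^ 3\<close> absorbs the \<open>O(p ^ 2)\<close> broadcast facts into
  \<open>m / p\<close>.\<close>

lemma mpc_load_bound:
  fixes K :: real
  assumes K: "K \<ge> 1" and large: "real m \<ge> real p ^ 3"
    and cells: "\<And>i s. i \<in> {1..k} \<Longrightarrow> s < p \<Longrightarrow> card (cell \<omega> i s) \<le> K ^ (k - 1) * m / q ^ (k - 1)"
    and weights: "\<And>s. s < p \<Longrightarrow> real (\<Sum>y | y \<in> facts \<and> \<omega> 0 (key y) = s. weight y) \<le> K * capacity"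
  shows "real (mpc_load prot p 2 \<omega> D) \<le> width * (const * K ^ k * target_load)"
proof -
  have pm: "real p ^ 2 \<le> real m / real p" "1 \<le> real m / real p"
  proof -
    show 1: "real p ^ 2 \<le> real m / real p"
      using large p by (simp add: field_simps power2_eq_square power3_eq_cube)
    have "1 \<le> real p ^ 2" using p by (intro one_le_power) simp
    then show "1 \<le> real m / real p" using 1 by linarith
  qed
  have Kk: "K ^ (k - 1) \<le> K ^ k" "K \<le> K ^ k" "1 \<le> K ^ k"
    using K k power_increasing[of 1 k K] by (auto intro: power_increasing)
  have T: "target_load > 0" by (rule target_load_pos)
  have KT: "x * target_load \<le> x * K ^ k * target_load" if "x \<ge> 0" for x
    using that T Kk(3) by (intro mult_right_mono) (auto simp: mult_le_cancel_left1)
  show ?thesis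
  proof (rule mpc_load_le)
    fix s assume s: "s < p"
    have cell: "real (card (cell \<omega> i s)) \<le> 2 ^ k * K ^ k * target_load" if i: "i \<in> {1..k}" for i
    proof -
      have "real (card (cell \<omega> i s)) \<le> K ^ (k - 1) * (m / q ^ (k - 1))" using cells[OF i s] by simp
      also have "m / q ^ (k - 1) \<le> 2 ^ k * target_load"
      proof -
        have "side ^ (k - 1) \<le> (2 * real q) ^ (k - 1)" using side by (intro power_mono) auto
        also have "\<dots> = 2 ^ (k - 1) * real q ^ (k - 1)" by (simp add: power_mult_distrib)
        also have "\<dots> \<le> 2 ^ k * real q ^ (k - 1)" by (intro mult_right_mono power_increasing) auto
        finally have "m * side ^ (k - 1) \<le> m * (2 ^ k * real q ^ (k - 1))" by (intro mult_left_mono) auto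
        then show ?thesis unfolding target_load(1) using q_pos side(1) by (simp add: field_simps)
      qed
      also have "K ^ (k - 1) * (2 ^ k * target_load) \<le> K ^ k * (2 ^ k * target_load)"
        using Kk(1) T by (intro mult_right_mono) auto
      finally show ?thesis using K by (simp add: mult_ac)
    qed
    have "real (bits_received prot p \<omega> D 0 s) \<le> real (width * ((\<Sum>i\<in>{1..k}. card (cell \<omega> i s))
     + (\<Sum>y | y \<in> facts \<and> \<omega> 0 (key y) = s. weight y) + k ^ 3 * 2 ^ k * p ^ 2))"
      using bits_received_0 by (rule of_nat_mono)
    also have "\<dots> = width * ((\<Sum>i\<in>{1..k}. real (card (cell \<omega> i s)))
     + real (\<Sum>y | y \<in> facts \<and> \<omega> 0 (key y) = s. weight y) + k * branching * real p ^ 2)"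
      by (simp add: branching_def power2_eq_square power3_eq_cube)
    also have "\<dots> \<le> width * (k * 2 ^ k * K ^ k * target_load + k * (1 + branching) * K ^ k * target_load
        + k * branching * K ^ k * target_load)"
    proof (intro mult_left_mono add_mono)
      have "(\<Sum>i\<in>{1..k}. real (card (cell \<omega> i s))) \<le> (\<Sum>i\<in>{1..k}. 2 ^ k * K ^ k * target_load)"
        using cell by (rule sum_mono)
      then show "(\<Sum>i\<in>{1..k}. real (card (cell \<omega> i s))) \<le> k * 2 ^ k * K ^ k * target_load" by simp
      have "K * capacity \<le> K ^ k * capacity"
        using Kk(2) capacity_def k branching T by (intro mult_right_mono) auto
      then show "real (\<Sum>y | y \<in> facts \<and> \<omega> 0 (key y) = s. weight y) \<le> k * (1 + branching) * K ^ k * target_load"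
        using weights[OF s] unfolding capacity_def by (simp add: mult_ac)
      have "k * branching * real p ^ 2 \<le> k * branching * target_load"
        using pm(1) target_load(3) branching by (intro mult_left_mono) auto
      also have "\<dots> \<le> k * branching * K ^ k * target_load" using branching by (intro KT) auto
      finally show "k * branching * real p ^ 2 \<le> k * branching * K ^ k * target_load" .
    qed simp
    also have "\<dots> \<le> width * (const * K ^ k * target_load)"
      using k branching K T by (intro mult_left_mono) (auto simp: const_def algebra_simps)
    finally show "real (bits_received prot p \<omega> D 0 s) \<le> width * (const * K ^ k * target_load)" .
    have "real_of_int (int (card (D s))) \<le> real_of_int (int k * \<lceil>real m / real p\<rceil>)"
      using card_D[OF s] by (simp only: of_int_le_iff)
    also have "\<dots> = k * real_of_int \<lceil>real m / real p\<rceil>" by simp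
    \<comment> \<open>As \<open>m / p \<ge> 1\<close>, the ceiling at most doubles it.\<close>
    also have "\<dots> \<le> k * (2 * (real m / real p))"
      using pm(2) by (intro mult_left_mono) linarith+
    finally have "real (card (D s)) \<le> k * (2 * (real m / real p))" by simp
    then have "real (card (D s)) * real fanout \<le> k * (2 * (real m / real p)) * (branching * side)"
      using fanout_le by (intro mult_mono) auto
    also have "\<dots> = 2 * k * branching * (m * side / p)" by simp
    also have "\<dots> = 2 * k * branching * target_load"
      unfolding target_load(2)[symmetric] using p by simp
    also have "\<dots> \<le> 2 * k * branching * K ^ k * target_load" using branching by (intro KT) auto
    also have "\<dots> \<le> const * K ^ k * target_load"
      using k branching K T by (intro mult_right_mono) (auto simp: const_def)
    finally have items: "real (card (D s) * fanout) \<le> const * K ^ k * target_load" by simp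
    have "real (bits_received prot p \<omega> D 1 s) \<le> width * real (card (D s) * fanout)"
      using bits_received_1[OF s] by (simp only: of_nat_mult[symmetric] of_nat_le_iff)
    also have "\<dots> \<le> width * (const * K ^ k * target_load)"
      using items by (intro mult_left_mono) auto
    finally show "real (bits_received prot p \<omega> D 1 s) \<le> width * (const * K ^ k * target_load)" .
  qed
qed

lemma width_le:
  assumes "n \<ge> 2"
  shows "real width \<le> 6 * k * log 2 n"
proof -
  have 1: "1 \<le> log 2 n" using assms by simp
  then have "real (nat \<lceil>log 2 n\<rceil> + 1) \<le> 3 * log 2 n" by linarith
  then have "2 * real k * real (nat \<lceil>log 2 n\<rceil> + 1) \<le> 2 * real k * (3 * log 2 n)"
    by (intro mult_left_mono) auto
  moreover have "real width = 2 * real k * real (nat \<lceil>log 2 n\<rceil> + 1)"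
    by (simp only: width_def of_nat_mult of_nat_numeral)
  ultimately show ?thesis by simp
qed

text \<open>Union bound over the \<open>k\<close> cell events and the weight event; outside them the
  deterministic bound applies.\<close>

lemma prob_load:
  assumes p2: "p \<ge> 2" and large: "real m \<ge> real p ^ 3"
  shows "measure_pmf.prob (rand prot) {\<omega>. real (mpc_load prot p 2 \<omega> D)
       \<le> 6 * k * const * 3 ^ k * log 2 p ^ k * (lw_bits k n m / real p powr (1 - 1 / real k))}
    \<ge> 1 - (k ^ 2 * 2 ^ k + 1) * exp 2 / p"
proof -
  define K where "K = 3 * log 2 p" \<comment> \<open>\<open>exp (2 - K)\<close> is \<open>O(1/p\<^sup>3)\<close>, against \<open>O(p\<^sup>2)\<close> events\<close>
  have log1: "1 \<le> log 2 p" using p2 by simp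
  then have K: "K \<ge> 1" by (simp add: K_def)
  have expK: "exp (2 - K) \<le> exp 2 / real p ^ 3"
  proof -
    have "ln 2 \<le> (1 :: real)" using ln_le_minus_one[of "2 :: real"] by simp
    then have "ln p \<le> log 2 p" using p2 unfolding log_def by (simp add: le_divide_eq)
    then have "exp (2 - K) \<le> exp (2 - 3 * ln p)" by (simp add: K_def)
    also have "\<dots> = exp 2 / exp (ln p) ^ 3" by (simp add: exp_diff exp_of_nat_mult[symmetric])
    also have "\<dots> = exp 2 / real p ^ 3" using p by simp
    finally show ?thesis .
  qed
  have "real p ^ 1 \<le> real p ^ 3" using p by (intro power_increasing) auto
  then have mp: "m \<ge> p" using large by simp
  let ?cells = "\<lambda>i \<omega>. \<exists>s<p. K ^ (k - 1) * m / q ^ (k - 1) < card (cell \<omega> i s)"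
  let ?weights = "\<lambda>\<omega>. \<exists>s<p. K * capacity < real (\<Sum>y | y \<in> facts \<and> \<omega> 0 (key y) = s. weight y)"
  let ?bound = "6 * k * const * 3 ^ k * log 2 p ^ k * (lw_bits k n m / real p powr (1 - 1 / real k))"
  let ?ok = "{\<omega>. real (mpc_load prot p 2 \<omega> D) \<le> ?bound}"
  have ok: "\<omega> \<in> ?ok" if "\<not> (\<exists>i\<in>{1..k}. ?cells i \<omega>)" "\<not> ?weights \<omega>" for \<omega>
  proof -
    have const: "const \<ge> 0" using branching k by (simp add: const_def)
    have "real (mpc_load prot p 2 \<omega> D) \<le> width * (const * K ^ k * target_load)"
      using that by (intro mpc_load_bound[OF K large]) (meson not_less)+
    also have "\<dots> \<le> (6 * k * log 2 n) * (const * K ^ k * target_load)"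
      using width_le[OF n_ge_2[OF p2 mp]] const K target_load_pos by (intro mult_right_mono) auto
    also have "\<dots> = 6 * k * const * 3 ^ k * log 2 p ^ k * (1 * log 2 n * target_load)"
      by (simp add: K_def power_mult_distrib)
    also have "\<dots> \<le> 6 * k * const * 3 ^ k * log 2 p ^ k * ((real k - 1) * log 2 n * target_load)"
      using k n_pos const log1 target_load_pos by (intro mult_left_mono mult_right_mono) auto
    also have "\<dots> = ?bound" by (simp add: lw_bits_def target_load_def)
    finally show ?thesis by simp
  qed
  have "measure_pmf.prob (rand prot) (- ?ok)
      \<le> measure_pmf.prob (rand prot) ({\<omega>. \<exists>i\<in>{1..k}. ?cells i \<omega>} \<union> {\<omega>. ?weights \<omega>})"
  proof (rule measure_pmf.finite_measure_mono)
    show "- ?ok \<subseteq> {\<omega>. \<exists>i\<in>{1..k}. ?cells i \<omega>} \<union> {\<omega>. ?weights \<omega>}" using ok by blast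
  qed simp
  also have "\<dots> \<le> measure_pmf.prob (rand prot) {\<omega>. \<exists>i\<in>{1..k}. ?cells i \<omega>}
      + measure_pmf.prob (rand prot) {\<omega>. ?weights \<omega>}"
    by (intro measure_Un_le) auto
  also have "\<dots> \<le> (\<Sum>i\<in>{1..k}. k * (2 ^ k * p * p * exp (2 - K))) + p * exp (2 - K)"
    using K capacity[OF mp] by (intro add_mono prob_pmf_union_bound prob_cell prob_weight) auto
  also have "\<dots> = (k ^ 2 * 2 ^ k * p ^ 2 + p) * exp (2 - K)"
    by (simp add: power2_eq_square algebra_simps)
  also have "\<dots> \<le> ((k ^ 2 * 2 ^ k + 1) * p ^ 2) * (exp 2 / real p ^ 3)"
  proof (rule mult_mono[OF _ expK])
    have "real p \<le> real p ^ 2" using p by (simp add: power2_eq_square)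
    then show "real (k ^ 2 * 2 ^ k * p ^ 2 + p) \<le> real ((k ^ 2 * 2 ^ k + 1) * p ^ 2)"
      by (simp add: distrib_right)
  qed auto
  also have "\<dots> = (k ^ 2 * 2 ^ k + 1) * exp 2 / p"
    using p by (simp add: field_simps power2_eq_square power3_eq_cube)
  finally have "measure_pmf.prob (rand prot) (- ?ok) \<le> (k ^ 2 * 2 ^ k + 1) * exp 2 / p" .
  moreover have "measure_pmf.prob (rand prot) ?ok = 1 - measure_pmf.prob (rand prot) (- ?ok)"
    using measure_pmf.prob_compl[of "- ?ok" "rand prot"] by (simp add: Compl_eq_Diff_UNIV[symmetric])
  ultimately show ?thesis by simp
qed

end

section \<open>Uniform constants and the final theorem\<close>

definition lw_const :: "nat \<Rightarrow> real" where
  "lw_const k = 6 * k * (k * 2 ^ k + k * (1 + k ^ 2 * 2 ^ k) + 2 * k * (k ^ 2 * 2 ^ k)) * 3 ^ k"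

theorem lemma4p7:
  fixes k :: nat
  assumes "k \<ge> 3"
  shows "\<exists>(A :: nat \<Rightarrow> nat \<Rightarrow> nat \<Rightarrow> statistics \<Rightarrow> protocol) (c :: real) (C :: real) (d :: nat)
            (\<epsilon> :: nat \<Rightarrow> real).
    c > 0 \<and> \<epsilon> \<longlonglongrightarrow> 0 \<and>
    (\<forall>(p :: nat) (n :: nat) (m :: nat) (S :: nat \<Rightarrow> tuple set) (D :: nat \<Rightarrow> fact set).
       p \<ge> 1 \<longrightarrow> real m \<ge> real p powr c \<longrightarrow> lw_instance k n m S \<longrightarrow> even_partition k p m S D \<longrightarrow>
       (let P = A p n m (heavy_hitters k p m S) in
          (\<forall>\<omega>\<in>set_pmf (rand P). mpc_result P p 2 \<omega> D = lw_join k S) \<and>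
          measure_pmf.prob (rand P)
            {\<omega>. real (mpc_load P p 2 \<omega> D)
                  \<le> C * log 2 (real p) ^ d * (lw_bits k n m / real p powr (1 - 1 / real k))}
            \<ge> 1 - \<epsilon> p))"
proof -
  \<comment> \<open>For \<open>p = 1\<close> the logarithm makes the claimed load vanish, so failure
    is allowed there; a single value does not affect the limit.\<close>
  define \<epsilon> where "\<epsilon> p = (if p = 1 then 1 else (k ^ 2 * 2 ^ k + 1) * exp 2 / real p)" for p :: nat
  have "(\<lambda>p. (k ^ 2 * 2 ^ k + 1) * exp 2 / real p) \<longlonglongrightarrow> 0"
    by (intro tendsto_divide_0[OF tendsto_const] filterlim_at_top_imp_at_infinity filterlim_real_sequentially)
  then have \<epsilon>: "\<epsilon> \<longlonglongrightarrow> 0"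
    by (rule Lim_transform_eventually) (auto simp: \<epsilon>_def eventually_sequentially intro!: exI[of _ 2])
  have main: "(let P = lw_protocol.prot k p n m (heavy_hitters k p m S) in
          (\<forall>\<omega>\<in>set_pmf (rand P). mpc_result P p 2 \<omega> D = lw_join k S) \<and>
          measure_pmf.prob (rand P)
            {\<omega>. real (mpc_load P p 2 \<omega> D)
                  \<le> lw_const k * log 2 (real p) ^ k * (lw_bits k n m / real p powr (1 - 1 / real k))}
            \<ge> 1 - \<epsilon> p)"
    if "p \<ge> 1" "real m \<ge> real p powr 3" "lw_instance k n m S" "even_partition k p m S D" for p n m S D
  proof -
    have large: "real m \<ge> real p ^ 3" using that(1,2) by (simp add: powr_numeral)
    have "real p ^ 3 > 0" using that(1) by simp
    then have "m > 0" using large by linarith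
    then interpret lw_input k p n m "heavy_hitters k p m S" S D
      using assms that by unfold_locales auto
    have "1 - \<epsilon> p \<le> measure_pmf.prob (rand prot)
            {\<omega>. real (mpc_load prot p 2 \<omega> D)
                  \<le> lw_const k * log 2 (real p) ^ k * (lw_bits k n m / real p powr (1 - 1 / real k))}"
    proof (cases "p = 1")
      case True
      then show ?thesis by (simp add: \<epsilon>_def)
    next
      case False
      have "6 * k * const * 3 ^ k = lw_const k"
        by (simp add: lw_const_def const_def branching_def algebra_simps)
      then show ?thesis using prob_load[OF _ large] False that(1) by (simp add: \<epsilon>_def)
    qed
    then show ?thesis using correct by (simp add: Let_def)
  qed
  show ?thesis
  proof (intro exI conjI allI impI)
    \<comment> \<open>The witnesses are found by unification: the exponent \<open>c = 3\<close>
      here, the protocol, \<open>C = lw_const k\<close> and \<open>d = k\<close> from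
      \<open>main\<close>.\<close>
    show "(3 :: real) > 0" by simp
  qed (rule \<epsilon>, rule main)
qed

end
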